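(* Let $f:\mathcal A(\Sigma)\to\mathcal A(\Sigma')$ be an inducible rooted cluster morphism, and suppose $f=f''\circ f'$ where $f':\mathcal A(\Sigma)\to\mathcal A(\Sigma'')$ is a surjective rooted cluster morphism and $f'':\mathcal A(\Sigma'')\to\mathcal A(\Sigma')$ is an injective rooted cluster morphism. Then $\mathcal A(\Sigma'')\cong\mathcal A(f(\Sigma))$ as rooted cluster algebras and $f$ is ideal.
   Context: A seed is a triple $\Sigma=(\mathbf{ex},\mathbf{fx},B)$ where $\mathbf{ex},\mathbf{fx}$ are disjoint finite or countable sets of indeterminates (exchangeable resp. frozen), $\mathbf x=\mathbf{ex}\sqcup\mathbf{fx}$, and $B=(b_{yz})_{y\in\mathbf x,z\in\mathbf{ex}}$ a locally finite integer matrix with skew-symmetrizable square part on $\mathbf{ex}\times\mathbf{ex}$. Mutation $\mu_x$ at $x\in\mathbf{ex}$: replace $x$ by $x'$ with $xx'=\prod_{b_{yx}>0}y^{b_{yx}}+\prod_{b_{yx}<0}y^{-b_{yx}}$, mutate $B$ by Fomin–Zelevinsky matrix mutation. $\mathcal A(\Sigma)$: $\Sigma$ with the $\mathbb Z$-subalgebra of $\mathbb Q(\mathbf x)$ generated by all cluster variables of seeds reachable by iterated mutations at exchangeable variables. A rooted cluster morphism $f:\mathcal A(\Sigma)\to\mathcal A(\Sigma')$ is a ring homomorphism with (CM1) $f(\mathbf{ex})\subseteq\mathbf{ex}'\sqcup\mathbb Z$, (CM2) $f(\mathbf{fx})\subseteq\mathbf x'\sqcup\mathbb Z$, (CM3)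 $f(\mu_{x_l}\circ\cdots\circ\mu_{x_1,\Sigma}(y))=\mu_{f(x_l)}\circ\cdots\circ\mu_{f(x_1),\Sigma'}(f(y))$ for all $y\in\mathbf x$ and all $\Sigma$-admissible mutation sequences whose image is $\Sigma'$-admissible (RHS read as $f(y)$ if $f(y)\in\mathbb Z$). Rooted cluster isomorphism: bijective rooted cluster morphism. $\mathcal L_{\Sigma,\mathbb Q}=\mathbb Q[x^{\pm1}\,(x\in\mathbf{ex}),y\,(y\in\mathbf{fx})]\supseteq\mathcal A(\Sigma)$; $f$ is inducible if it extends to a ring homomorphism $\mathcal L_{\Sigma,\mathbb Q}\to\mathcal L_{\Sigma',\mathbb Q}$. Image seed: $f(\Sigma)=(\mathbf{ex}'\cap f(\mathbf{ex}),(\mathbf x'\cap f(\mathbf x))\setminus(\mathbf{ex}'\cap f(\mathbf{ex})),B'[\mathbf x'\cap f(\mathbf x)])$ (submatrix of $B'$ with the corresponding rows and columns). $f$ is ideal if $\mathcal A(f(\Sigma))=f(\mathcal A(\Sigma))$. *)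

theory Defs
  imports Complex_Main "HOL-Library.Poly_Mapping" "HOL-Computational_Algebra.Fraction_Field"
begin

text \<open>Indeterminates are indexed by natural numbers (finite or countable sets of
indeterminates).  Polynomials over Q are finitely supported functions from monomials
(finitely supported exponent vectors) to Q; the ambient field is their fraction field.\<close>

type_synonym qpoly = "(nat \<Rightarrow>\<^sub>0 nat) \<Rightarrow>\<^sub>0 rat"
type_synonym qfield = "qpoly fract"

definition Xvar :: "nat \<Rightarrow> qfield" where
  "Xvar k = Fract (Poly_Mapping.single (Poly_Mapping.single k 1) 1) 1"

definition qconst :: "rat \<Rightarrow> qfield" where
  "qconst q = Fract (Poly_Mapping.single 0 q) 1"

text \<open>A seed: exchangeable and frozen indeterminates (given by their indices) and
the exchange matrix, entry \<open>bmat S y z\<close> being b_{yz}; only entries with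
y in ex \<union> fx and z in ex are meaningful.\<close>

record seed =
  exv :: "nat set"
  frv :: "nat set"
  bmat :: "nat \<Rightarrow> nat \<Rightarrow> int"

definition allv :: "seed \<Rightarrow> nat set" where
  "allv S = exv S \<union> frv S"

definition valid_seed :: "seed \<Rightarrow> bool" where
  "valid_seed S \<longleftrightarrow>
     exv S \<inter> frv S = {} \<and>
     (\<forall>z\<in>exv S. finite {y \<in> allv S. bmat S y z \<noteq> 0}) \<and>
     (\<forall>y\<in>allv S. finite {z \<in> exv S. bmat S y z \<noteq> 0}) \<and>
     (\<exists>d :: nat \<Rightarrow> int. (\<forall>k\<in>exv S. d k > 0) \<and>
        (\<forall>i\<in>exv S. \<forall>j\<in>exv S. d i * bmat S i j = - (d j * bmat S j i)))"

text \<open>A state of a seed obtained by mutations: the cluster variable at each position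
and the current exchange matrix (indexed by positions).\<close>

type_synonym mstate = "(nat \<Rightarrow> qfield) \<times> (nat \<Rightarrow> nat \<Rightarrow> int)"

definition mutate :: "seed \<Rightarrow> nat \<Rightarrow> mstate \<Rightarrow> mstate" where
  "mutate S k st =
    (let v = fst st; B = snd st;
         pplus = (\<Prod>y\<in>{y \<in> allv S. B y k > 0}. v y ^ nat (B y k));
         pminus = (\<Prod>y\<in>{y \<in> allv S. B y k < 0}. v y ^ nat (- B y k));
         B' = (\<lambda>y z. if y = k \<or> z = k then - B y z
                      else B y z + (\<bar>B y k\<bar> * B k z + B y k * \<bar>B k z\<bar>) div 2)
     in (v(k := (pplus + pminus) / v k), B'))"

definition init_state :: "seed \<Rightarrow> mstate" where
  "init_state S = (Xvar, bmat S)"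

definition mutseq :: "seed \<Rightarrow> nat list \<Rightarrow> mstate" where
  "mutseq S ks = foldl (\<lambda>st k. mutate S k st) (init_state S) ks"

definition cvar :: "seed \<Rightarrow> nat list \<Rightarrow> nat \<Rightarrow> qfield" where
  "cvar S ks y = fst (mutseq S ks) y"

definition cluster_vars :: "seed \<Rightarrow> qfield set" where
  "cluster_vars S = {cvar S ks y | ks y. ks \<in> lists (exv S) \<and> y \<in> allv S}"

inductive_set clalg :: "seed \<Rightarrow> qfield set" for S where
  gen: "a \<in> cluster_vars S \<Longrightarrow> a \<in> clalg S"
| one: "1 \<in> clalg S"
| add: "a \<in> clalg S \<Longrightarrow> b \<in> clalg S \<Longrightarrow> a + b \<in> clalg S"
| neg: "a \<in> clalg S \<Longrightarrow> - a \<in> clalg S"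
| mult: "a \<in> clalg S \<Longrightarrow> b \<in> clalg S \<Longrightarrow> a * b \<in> clalg S"

inductive_set laurent :: "seed \<Rightarrow> qfield set" for S where
  const: "qconst q \<in> laurent S"
| var: "k \<in> allv S \<Longrightarrow> Xvar k \<in> laurent S"
| inv: "k \<in> exv S \<Longrightarrow> inverse (Xvar k) \<in> laurent S"
| add: "a \<in> laurent S \<Longrightarrow> b \<in> laurent S \<Longrightarrow> a + b \<in> laurent S"
| mult: "a \<in> laurent S \<Longrightarrow> b \<in> laurent S \<Longrightarrow> a * b \<in> laurent S"

definition ring_hom_on :: "qfield set \<Rightarrow> qfield set \<Rightarrow> (qfield \<Rightarrow> qfield) \<Rightarrow> bool" where
  "ring_hom_on R R' f \<longleftrightarrow>
     f ` R \<subseteq> R' \<and> f 1 = 1 \<and>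
     (\<forall>a\<in>R. \<forall>b\<in>R. f (a + b) = f a + f b \<and> f (a * b) = f a * f b)"

definition is_int :: "qfield \<Rightarrow> bool" where
  "is_int a \<longleftrightarrow> a \<in> range of_int"

text \<open>Admissible pairs of mutation sequences: ks is a sequence of exchangeable positions
of S, ks' of S', and at each step the variable of S' mutated is the image under f of
the variable of S mutated (i.e. the image sequence is S'-admissible).\<close>

definition compatible_seqs ::
  "(qfield \<Rightarrow> qfield) \<Rightarrow> seed \<Rightarrow> seed \<Rightarrow> nat list \<Rightarrow> nat list \<Rightarrow> bool" where
  "compatible_seqs f S S' ks ks' \<longleftrightarrow>
     ks \<in> lists (exv S) \<and> ks' \<in> lists (exv S') \<and> length ks = length ks' \<and>
     (\<forall>i < length ks. f (cvar S (take i ks) (ks ! i)) = cvar S' (take i ks') (ks' ! i))"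

definition rooted_cluster_morphism ::
  "seed \<Rightarrow> seed \<Rightarrow> (qfield \<Rightarrow> qfield) \<Rightarrow> bool" where
  "rooted_cluster_morphism S S' f \<longleftrightarrow>
     ring_hom_on (clalg S) (clalg S') f \<and>
     (\<forall>k\<in>exv S. f (Xvar k) \<in> Xvar ` exv S' \<or> is_int (f (Xvar k))) \<and>
     (\<forall>k\<in>frv S. f (Xvar k) \<in> Xvar ` allv S' \<or> is_int (f (Xvar k))) \<and>
     (\<forall>ks ks'. compatible_seqs f S S' ks ks' \<longrightarrow>
        (\<forall>y\<in>allv S.
           (is_int (f (Xvar y)) \<longrightarrow> f (cvar S ks y) = f (Xvar y)) \<and>
           (\<forall>j\<in>allv S'. f (Xvar y) = Xvar j \<longrightarrow> f (cvar S ks y) = cvar S' ks' j)))"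

definition rooted_cluster_iso ::
  "seed \<Rightarrow> seed \<Rightarrow> (qfield \<Rightarrow> qfield) \<Rightarrow> bool" where
  "rooted_cluster_iso S S' f \<longleftrightarrow>
     rooted_cluster_morphism S S' f \<and> bij_betw f (clalg S) (clalg S')"

definition clalg_iso :: "seed \<Rightarrow> seed \<Rightarrow> bool" where
  "clalg_iso S S' \<longleftrightarrow> (\<exists>g. rooted_cluster_iso S S' g)"

definition inducible :: "seed \<Rightarrow> seed \<Rightarrow> (qfield \<Rightarrow> qfield) \<Rightarrow> bool" where
  "inducible S S' f \<longleftrightarrow>
     (\<exists>g. ring_hom_on (laurent S) (laurent S') g \<and> (\<forall>a\<in>clalg S. g a = f a))"

definition image_seed :: "seed \<Rightarrow> seed \<Rightarrow> (qfield \<Rightarrow> qfield) \<Rightarrow> seed" where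
  "image_seed S S' f =
     (let E = {j \<in> exv S'. Xvar j \<in> f ` Xvar ` exv S};
          A = {j \<in> allv S'. Xvar j \<in> f ` Xvar ` allv S}
      in \<lparr>exv = E, frv = A - E, bmat = bmat S'\<rparr>)"

definition ideal_morphism :: "seed \<Rightarrow> seed \<Rightarrow> (qfield \<Rightarrow> qfield) \<Rightarrow> bool" where
  "ideal_morphism S S' f \<longleftrightarrow> clalg (image_seed S S' f) = f ` clalg S"

end

theory Submission
  imports Defs
begin

text \<open>An injective rooted cluster morphism renames variables, say by an injection s from the
  variables of the seed S'' into those of S'.  Comparing the two exchange relations at a variable
  shows that the columns of the matrix of S' indexed by the renamed exchangeable variables vanish
  outside the renamed variables, so mutating the renamed variables in S' stays inside the subseed
  they span.  It remains to see that this subseed is the image seed of f, that is, that every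
  (exchangeable) variable of S'' is the image of an (exchangeable) variable of S.  Since f extends
  to the Laurent ring, the Laurent phenomenon puts every f(a) into the Laurent polynomials in
  the image variables, with only the images of exchangeable variables inverted.  Applied to a
  preimage of a variable this shows that the variable is hit; applied to a preimage of the variable
  obtained by one mutation it shows that it is hit by an exchangeable variable, because an exchange
  polynomial is not divisible by a variable.

  The Laurent phenomenon is proved by induction on the length of the mutation path.  A cluster
  variable at the end of a path starting with directions j, k is a Laurent polynomial in the
  cluster after the step j and in the one after the steps j, k, j.  The denominators of the
  two expressions over the initial Laurent ring are coprime: an extra frozen variable that occurs
  only in column j makes the exchange polynomial at j linear, hence prime, and the two other
  new variables do not vanish at a suitable rational zero of it.\<close>

section \<open>Partial evaluation of rational functions\<close>

text \<open>Makes the ambient field itself a target of \<open>poly_eval\<close>, so that one notion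
  of substitution covers rational points and rational functions.\<close>

instance fract :: ("{idom, ring_char_0}") field_char_0
proof
  show "inj (of_nat :: nat \<Rightarrow> 'a fract)"
    by (rule injI) (simp add: of_nat_fract eq_fract)
qed

definition mon_eval :: "(nat \<Rightarrow> 'a::comm_monoid_mult) \<Rightarrow> (nat \<Rightarrow>\<^sub>0 nat) \<Rightarrow> 'a" where
  "mon_eval \<phi> m = (\<Prod>i\<in>Poly_Mapping.keys m. \<phi> i ^ Poly_Mapping.lookup m i)"

lemma mon_eval_superset:
  assumes "finite F" "Poly_Mapping.keys m \<subseteq> F"
  shows "mon_eval \<phi> m = (\<Prod>i\<in>F. \<phi> i ^ Poly_Mapping.lookup m i)"
  unfolding mon_eval_def
  by (rule prod.mono_neutral_left) (use assms in \<open>auto simp: in_keys_iff\<close>)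

lemma mon_eval_add: "mon_eval \<phi> (a + b) = mon_eval \<phi> a * mon_eval \<phi> b"
proof -
  let ?F = "Poly_Mapping.keys a \<union> Poly_Mapping.keys b"
  have "mon_eval \<phi> (a + b) = (\<Prod>i\<in>?F. \<phi> i ^ Poly_Mapping.lookup (a + b) i)"
    by (rule mon_eval_superset) (use keys_add[of a b] in auto)
  also have "\<dots> = (\<Prod>i\<in>?F. \<phi> i ^ Poly_Mapping.lookup a i) * (\<Prod>i\<in>?F. \<phi> i ^ Poly_Mapping.lookup b i)"
    by (simp add: lookup_add power_add prod.distrib)
  also have "\<dots> = mon_eval \<phi> a * mon_eval \<phi> b"
    by (simp add: mon_eval_superset[of ?F])
  finally show ?thesis .
qed

definition poly_eval :: "(nat \<Rightarrow> 'a::field_char_0) \<Rightarrow> qpoly \<Rightarrow> 'a" where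
  "poly_eval \<phi> p = (\<Sum>m\<in>Poly_Mapping.keys p. of_rat (Poly_Mapping.lookup p m) * mon_eval \<phi> m)"

lemma poly_eval_superset:
  assumes "finite F" "Poly_Mapping.keys p \<subseteq> F"
  shows "poly_eval \<phi> p = (\<Sum>m\<in>F. of_rat (Poly_Mapping.lookup p m) * mon_eval \<phi> m)"
  unfolding poly_eval_def
  by (rule sum.mono_neutral_left) (use assms in \<open>auto simp: in_keys_iff\<close>)

lemma poly_eval_add: "poly_eval \<phi> (p + q) = poly_eval \<phi> p + poly_eval \<phi> q"
proof -
  let ?F = "Poly_Mapping.keys p \<union> Poly_Mapping.keys q"
  have "poly_eval \<phi> (p + q) = (\<Sum>m\<in>?F. of_rat (Poly_Mapping.lookup (p + q) m) * mon_eval \<phi> m)"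
    by (rule poly_eval_superset) (use keys_add[of p q] in auto)
  also have "\<dots> = (\<Sum>m\<in>?F. of_rat (Poly_Mapping.lookup p m) * mon_eval \<phi> m)
      + (\<Sum>m\<in>?F. of_rat (Poly_Mapping.lookup q m) * mon_eval \<phi> m)"
    by (simp add: lookup_add of_rat_add distrib_right sum.distrib)
  also have "\<dots> = poly_eval \<phi> p + poly_eval \<phi> q"
    by (simp add: poly_eval_superset[of ?F])
  finally show ?thesis .
qed

lemma poly_eval_0 [simp]: "poly_eval \<phi> 0 = 0"
  by (simp add: poly_eval_def)

lemma poly_eval_single: "poly_eval \<phi> (Poly_Mapping.single m c) = of_rat c * mon_eval \<phi> m"
  by (simp add: poly_eval_def)

lemma poly_eval_sum: "poly_eval \<phi> (\<Sum>i\<in>I. h i) = (\<Sum>i\<in>I. poly_eval \<phi> (h i))"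
  by (induction I rule: infinite_finite_induct) (simp_all add: poly_eval_add)

lemma qpoly_eq_sum_single:
  "(p :: qpoly) = (\<Sum>m\<in>Poly_Mapping.keys p. Poly_Mapping.single m (Poly_Mapping.lookup p m))"
proof (rule poly_mapping_eqI)
  fix k
  show "Poly_Mapping.lookup p k
    = Poly_Mapping.lookup (\<Sum>m\<in>Poly_Mapping.keys p. Poly_Mapping.single m (Poly_Mapping.lookup p m)) k"
    by (cases "k \<in> Poly_Mapping.keys p")
       (auto simp: lookup_sum lookup_single when_def in_keys_iff sum.delta)
qed

lemma poly_eval_mult: "poly_eval \<phi> (p * q) = poly_eval \<phi> p * poly_eval \<phi> q"
proof -
  let ?s = "\<lambda>p m. Poly_Mapping.single m (Poly_Mapping.lookup p m) :: qpoly"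
  have "p * q = (\<Sum>a\<in>Poly_Mapping.keys p. \<Sum>b\<in>Poly_Mapping.keys q. ?s p a * ?s q b)"
    by (subst qpoly_eq_sum_single[of p], subst qpoly_eq_sum_single[of q]) (simp add: sum_product)
  then have "poly_eval \<phi> (p * q)
      = (\<Sum>a\<in>Poly_Mapping.keys p. \<Sum>b\<in>Poly_Mapping.keys q. poly_eval \<phi> (?s p a) * poly_eval \<phi> (?s q b))"
    by (simp add: poly_eval_sum mult_single poly_eval_single mon_eval_add of_rat_mult algebra_simps)
  also have "\<dots> = poly_eval \<phi> p * poly_eval \<phi> q"
    unfolding poly_eval_single poly_eval_def[of \<phi> p] poly_eval_def[of \<phi> q] sum_product ..
  finally show ?thesis .
qed

lemma mon_eval_0 [simp]: "mon_eval \<phi> 0 = 1"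
  by (simp add: mon_eval_def)

lemma poly_eval_1 [simp]: "poly_eval \<phi> 1 = 1"
  using poly_eval_single[of \<phi> 0 1] by simp

text \<open>Substitution is only a partial map on the field of fractions, hence a relation: some
  representation must have a denominator that does not vanish under the substitution.\<close>

definition evaluates :: "(nat \<Rightarrow> 'a::field_char_0) \<Rightarrow> qfield \<Rightarrow> 'a \<Rightarrow> bool" where
  "evaluates \<phi> z w \<longleftrightarrow> (\<exists>a b. poly_eval \<phi> b \<noteq> 0 \<and> z = Fract a b \<and> w = poly_eval \<phi> a / poly_eval \<phi> b)"

lemma evaluatesE:
  assumes "evaluates \<phi> z w"
  obtains a b where "b \<noteq> 0" "poly_eval \<phi> b \<noteq> 0" "z = Fract a b" "w = poly_eval \<phi> a / poly_eval \<phi> b"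
  using assms unfolding evaluates_def by (metis poly_eval_0)

text \<open>Two fractions for \<open>z\<close> cross-multiply to a polynomial identity, which
  \<open>poly_eval\<close> preserves. Many arguments below compute a value in two ways and
  compare.\<close>

lemma evaluates_unique: "evaluates \<phi> z w \<Longrightarrow> evaluates \<phi> z w' \<Longrightarrow> w = w'"
proof (elim evaluatesE)
  fix a b c d
  assume *: "b \<noteq> 0" "poly_eval \<phi> b \<noteq> 0" "z = Fract a b" "w = poly_eval \<phi> a / poly_eval \<phi> b"
    "d \<noteq> 0" "poly_eval \<phi> d \<noteq> 0" "z = Fract c d" "w' = poly_eval \<phi> c / poly_eval \<phi> d"
  then have "a * d = c * b"
    using eq_fract(1) by metis
  then have "poly_eval \<phi> a * poly_eval \<phi> d = poly_eval \<phi> c * poly_eval \<phi> b"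
    by (metis poly_eval_mult)
  with * show "w = w'"
    by (simp add: frac_eq_eq)
qed

lemma evaluates_add: "evaluates \<phi> x u \<Longrightarrow> evaluates \<phi> y v \<Longrightarrow> evaluates \<phi> (x + y) (u + v)"
proof (elim evaluatesE)
  fix a b c d
  assume *: "b \<noteq> 0" "poly_eval \<phi> b \<noteq> 0" "x = Fract a b" "u = poly_eval \<phi> a / poly_eval \<phi> b"
    "d \<noteq> 0" "poly_eval \<phi> d \<noteq> 0" "y = Fract c d" "v = poly_eval \<phi> c / poly_eval \<phi> d"
  have "x + y = Fract (a * d + c * b) (b * d)" "poly_eval \<phi> (b * d) \<noteq> 0"
    using * by (simp_all add: poly_eval_mult)
  moreover have "u + v = poly_eval \<phi> (a * d + c * b) / poly_eval \<phi> (b * d)"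
    using * by (simp add: poly_eval_mult poly_eval_add add_frac_eq)
  ultimately show ?thesis
    unfolding evaluates_def by blast
qed

lemma evaluates_mult: "evaluates \<phi> x u \<Longrightarrow> evaluates \<phi> y v \<Longrightarrow> evaluates \<phi> (x * y) (u * v)"
proof (elim evaluatesE)
  fix a b c d
  assume *: "b \<noteq> 0" "poly_eval \<phi> b \<noteq> 0" "x = Fract a b" "u = poly_eval \<phi> a / poly_eval \<phi> b"
    "d \<noteq> 0" "poly_eval \<phi> d \<noteq> 0" "y = Fract c d" "v = poly_eval \<phi> c / poly_eval \<phi> d"
  have "x * y = Fract (a * c) (b * d)" "poly_eval \<phi> (b * d) \<noteq> 0"
    using * by (simp_all add: poly_eval_mult)
  moreover have "u * v = poly_eval \<phi> (a * c) / poly_eval \<phi> (b * d)"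
    using * by (simp add: poly_eval_mult)
  ultimately show ?thesis
    unfolding evaluates_def by blast
qed

lemma evaluates_inverse: "evaluates \<phi> x u \<Longrightarrow> u \<noteq> 0 \<Longrightarrow> evaluates \<phi> (inverse x) (inverse u)"
proof (elim evaluatesE)
  fix a b
  assume *: "u \<noteq> 0" "b \<noteq> 0" "poly_eval \<phi> b \<noteq> 0" "x = Fract a b" "u = poly_eval \<phi> a / poly_eval \<phi> b"
  then have "inverse x = Fract b a" "poly_eval \<phi> a \<noteq> 0" "inverse u = poly_eval \<phi> b / poly_eval \<phi> a"
    by auto
  then show ?thesis
    unfolding evaluates_def by blast
qed

lemma evaluates_divide:
  "evaluates \<phi> x u \<Longrightarrow> evaluates \<phi> y v \<Longrightarrow> v \<noteq> 0 \<Longrightarrow> evaluates \<phi> (x / y) (u / v)"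
  by (simp add: divide_inverse evaluates_mult evaluates_inverse)

lemma evaluates_qconst: "evaluates \<phi> (qconst q) (of_rat q)"
  unfolding evaluates_def qconst_def
  by (intro exI[of _ "Poly_Mapping.single 0 q"] exI[of _ 1]) (simp add: poly_eval_single)

lemma evaluates_Xvar: "evaluates \<phi> (Xvar k) (\<phi> k)"
  unfolding evaluates_def Xvar_def
  by (intro exI[of _ "Poly_Mapping.single (Poly_Mapping.single k 1) 1"] exI[of _ 1])
     (simp add: poly_eval_single mon_eval_def)

lemma qconst_0: "qconst 0 = 0" and qconst_1: "qconst 1 = 1" and qconst_m1: "qconst (-1) = -1"
  by (simp_all add: qconst_def Zero_fract_def One_fract_def single_uminus)

lemma qconst_add: "qconst (a + b) = qconst a + qconst b"
  and qconst_mult: "qconst (a * b) = qconst a * qconst b"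
  by (simp_all add: qconst_def single_add mult_single)

lemma evaluates_1: "evaluates \<phi> 1 1" and evaluates_0: "evaluates \<phi> 0 0"
  using evaluates_qconst[of \<phi> 1] evaluates_qconst[of \<phi> 0] by (simp_all add: qconst_0 qconst_1)

lemma evaluates_power: "evaluates \<phi> x u \<Longrightarrow> evaluates \<phi> (x ^ n) (u ^ n)"
  by (induction n) (simp_all add: evaluates_1 evaluates_mult)

lemma evaluates_prod:
  "(\<And>i. i \<in> I \<Longrightarrow> evaluates \<phi> (h i) (k i)) \<Longrightarrow> evaluates \<phi> (\<Prod>i\<in>I. h i) (\<Prod>i\<in>I. k i)"
  by (induction I rule: infinite_finite_induct) (simp_all add: evaluates_1 evaluates_mult)

lemma evaluates_sum:
  "(\<And>i. i \<in> I \<Longrightarrow> evaluates \<phi> (h i) (k i)) \<Longrightarrow> evaluates \<phi> (\<Sum>i\<in>I. h i) (\<Sum>i\<in>I. k i)"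
  by (induction I rule: infinite_finite_induct) (simp_all add: evaluates_0 evaluates_add)

lemma evaluates_monomial:
  "(\<And>y. y \<in> A \<Longrightarrow> evaluates \<phi> (v y) (w y)) \<Longrightarrow>
    evaluates \<phi> (\<Prod>y\<in>A. v y ^ e y) (\<Prod>y\<in>A. w y ^ e y)"
  by (intro evaluates_prod evaluates_power)

text \<open>Cluster variables are subtraction-free expressions, so they are nonzero because their value
  at the all-ones point is positive.\<close>

definition positive :: "qfield \<Rightarrow> bool" where
  "positive z \<longleftrightarrow> (\<exists>w::rat. evaluates (\<lambda>_. 1) z w \<and> w > 0)"

lemma positive_nonzero: "positive z \<Longrightarrow> z \<noteq> 0"
  unfolding positive_def using evaluates_0[where 'a = rat] evaluates_unique[of _ 0] by (metis less_irrefl)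

lemma positive_add: "positive x \<Longrightarrow> positive y \<Longrightarrow> positive (x + y)"
  unfolding positive_def using evaluates_add add_pos_pos by blast

lemma positive_mult: "positive x \<Longrightarrow> positive y \<Longrightarrow> positive (x * y)"
  unfolding positive_def using evaluates_mult mult_pos_pos by blast

lemma positive_divide: "positive x \<Longrightarrow> positive y \<Longrightarrow> positive (x / y)"
  unfolding positive_def using evaluates_divide divide_pos_pos by (metis less_irrefl)

lemma positive_Xvar: "positive (Xvar k)"
  unfolding positive_def using evaluates_Xvar zero_less_one by blast

lemma positive_1: "positive 1"
  unfolding positive_def using evaluates_1 zero_less_one by blast

lemma positive_power: "positive x \<Longrightarrow> positive (x ^ n)"
  by (induction n) (simp_all add: positive_1 positive_mult)

lemma positive_monomial: "(\<And>y. y \<in> A \<Longrightarrow> positive (v y)) \<Longrightarrow> positive (\<Prod>y\<in>A. v y ^ e y)"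
  by (induction A rule: infinite_finite_induct) (simp_all add: positive_1 positive_mult positive_power)

lemma Xvar_nonzero [simp]: "Xvar k \<noteq> 0"
  by (rule positive_nonzero[OF positive_Xvar])

lemma Xvar_eq_iff [simp]: "Xvar i = Xvar j \<longleftrightarrow> i = j"
proof
  assume eq: "Xvar i = Xvar j"
  define \<phi> :: "nat \<Rightarrow> rat" where "\<phi> k = (if k = i then 0 else 1)" for k
  have "\<phi> i = \<phi> j"
    using evaluates_Xvar[of \<phi> i] evaluates_Xvar[of \<phi> j] unfolding eq by (rule evaluates_unique)
  then show "i = j"
    by (simp add: \<phi>_def split: if_splits)
qed simp

text \<open>Generalises \<open>laurent\<close> to an arbitrary cluster \<open>v\<close>;
  \<open>I\<close> lists the inverted positions. This covers mutated clusters, and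
  \<open>I = A\<close> gives the ring in which frozen variables are inverted too.\<close>

inductive_set laurent_ring :: "nat set \<Rightarrow> nat set \<Rightarrow> (nat \<Rightarrow> qfield) \<Rightarrow> qfield set"
  for I A v where
  const: "qconst q \<in> laurent_ring I A v"
| var: "k \<in> A \<Longrightarrow> v k \<in> laurent_ring I A v"
| inv: "k \<in> I \<Longrightarrow> inverse (v k) \<in> laurent_ring I A v"
| add: "a \<in> laurent_ring I A v \<Longrightarrow> b \<in> laurent_ring I A v \<Longrightarrow> a + b \<in> laurent_ring I A v"
| mult: "a \<in> laurent_ring I A v \<Longrightarrow> b \<in> laurent_ring I A v \<Longrightarrow> a * b \<in> laurent_ring I A v"

lemma laurent_eq_laurent_ring: "laurent S = laurent_ring (exv S) (allv S) Xvar"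
proof
  show "laurent S \<subseteq> laurent_ring (exv S) (allv S) Xvar"
    by (rule subsetI, erule laurent.induct) (auto intro: laurent_ring.intros)
  show "laurent_ring (exv S) (allv S) Xvar \<subseteq> laurent S"
    by (rule subsetI, erule laurent_ring.induct) (auto intro: laurent.intros)
qed

lemma laurent_ring_mono:
  assumes "I \<subseteq> I'" "A \<subseteq> A'" "z \<in> laurent_ring I A v"
  shows "z \<in> laurent_ring I' A' v"
  using assms(3) by induction (use assms in \<open>auto intro: laurent_ring.intros\<close>)

lemma laurent_ring_0: "0 \<in> laurent_ring I A v" and laurent_ring_1: "1 \<in> laurent_ring I A v"
  using laurent_ring.const[of 0 I A v] laurent_ring.const[of 1 I A v] by (simp_all add: qconst_0 qconst_1)

lemma laurent_ring_uminus: "a \<in> laurent_ring I A v \<Longrightarrow> - a \<in> laurent_ring I A v"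
  using laurent_ring.mult[OF laurent_ring.const[of "-1" I A v], of a] by (simp add: qconst_m1)

lemma laurent_ring_power: "a \<in> laurent_ring I A v \<Longrightarrow> a ^ n \<in> laurent_ring I A v"
  by (induction n) (auto intro: laurent_ring_1 laurent_ring.mult)

lemma laurent_ring_prod:
  "(\<And>i. i \<in> F \<Longrightarrow> h i \<in> laurent_ring I A v) \<Longrightarrow> (\<Prod>i\<in>F. h i) \<in> laurent_ring I A v"
  by (induction F rule: infinite_finite_induct) (auto intro: laurent_ring_1 laurent_ring.mult)

lemma laurent_ring_sum:
  "(\<And>i. i \<in> F \<Longrightarrow> h i \<in> laurent_ring I A v) \<Longrightarrow> (\<Sum>i\<in>F. h i) \<in> laurent_ring I A v"
  by (induction F rule: infinite_finite_induct) (auto intro: laurent_ring_0 laurent_ring.add)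

lemma laurent_ring_monomial:
  "F \<subseteq> A \<Longrightarrow> (\<Prod>i\<in>F. v i ^ e i) \<in> laurent_ring I A v"
  by (intro laurent_ring_prod laurent_ring_power) (auto intro: laurent_ring.var)

text \<open>Only the inverted variables need nonzero values. A frozen variable may be set to
  \<open>0\<close>, which is how divisibility by it is tested.\<close>

lemma evaluates_laurent_ring:
  assumes "z \<in> laurent_ring I A v" "\<And>k. k \<in> I \<union> A \<Longrightarrow> evaluates \<phi> (v k) (u k)"
    "\<And>k. k \<in> I \<Longrightarrow> u k \<noteq> 0"
  shows "\<exists>w. evaluates \<phi> z w"
  using assms(1)
proof induction
  case (const q) then show ?case using evaluates_qconst by blast
next
  case (var k) then show ?case using assms(2) by blast
next
  case (inv k) then show ?case using assms(2,3) evaluates_inverse by (metis UnI1)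
next
  case (add a b) then show ?case using evaluates_add by blast
next
  case (mult a b) then show ?case using evaluates_mult by blast
qed

text \<open>Identifies the embedding of the rationals produced by \<open>poly_eval\<close> with the
  constants of the Laurent ring.\<close>

lemma of_rat_eq_qconst: "of_rat q = qconst q"
proof -
  have nat: "qconst (of_nat n) = of_nat n" for n
    by (induction n) (simp_all add: qconst_0 qconst_1 qconst_add)
  have int: "qconst (of_int n) = of_int n" for n
  proof (cases n rule: int_cases2)
    case (nonneg m) then show ?thesis using nat[of m] by simp
  next
    case (nonpos m) 
    have "qconst (of_int n) = qconst (-1) * qconst (of_nat m)" using nonpos by (simp flip: qconst_mult)
    then show ?thesis using nat[of m] nonpos by (simp add: qconst_m1)
  qed
  obtain a b where q: "q = of_int a / of_int b" "b \<noteq> 0"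
    by (metis Fract_of_int_quotient Rat_cases less_irrefl)
  then have "qconst q * of_int b = of_int a"
    using int[of a] int[of b] by (metis nonzero_eq_divide_eq of_int_eq_0_iff qconst_mult)
  with q show ?thesis
    by (simp add: of_rat_divide nonzero_divide_eq_eq)
qed

text \<open>A Laurent polynomial is a formula that can be read in any cluster \<open>v\<close> whose
  inverted entries are nonzero.\<close>

lemma laurent_ring_subst:
  assumes "z \<in> laurent_ring I A Xvar" "\<And>k. k \<in> I \<Longrightarrow> v k \<noteq> 0" 
  shows "\<exists>w\<in>laurent_ring I A v. evaluates v z w"
  using assms(1)
proof induction
  case (const q) then show ?case using evaluates_qconst laurent_ring.const of_rat_eq_qconst by metis
next
  case (var k) then show ?case using evaluates_Xvar laurent_ring.var by metis
next
  case (inv k) then show ?case using evaluates_Xvar evaluates_inverse laurent_ring.inv assms(2) by metis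
next
  case (add a b) then show ?case using evaluates_add laurent_ring.add by metis
next
  case (mult a b) then show ?case using evaluates_mult laurent_ring.mult by metis
qed

section \<open>Mutation\<close>

definition exch :: "nat set \<Rightarrow> (nat \<Rightarrow> nat \<Rightarrow> int) \<Rightarrow> nat \<Rightarrow> (nat \<Rightarrow> qfield) \<Rightarrow> qfield" where
  "exch A B k v = (\<Prod>y\<in>{y \<in> A. B y k > 0}. v y ^ nat (B y k))
     + (\<Prod>y\<in>{y \<in> A. B y k < 0}. v y ^ nat (- B y k))"

definition matrix_mutation :: "nat \<Rightarrow> (nat \<Rightarrow> nat \<Rightarrow> int) \<Rightarrow> nat \<Rightarrow> nat \<Rightarrow> int" where
  "matrix_mutation k B y z = (if y = k \<or> z = k then - B y z
     else B y z + (\<bar>B y k\<bar> * B k z + B y k * \<bar>B k z\<bar>) div 2)"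

lemma mutate_eq:
  "mutate S k (v, B) = (v(k := exch (allv S) B k v / v k), matrix_mutation k B)"
  by (simp add: mutate_def exch_def matrix_mutation_def[abs_def] Let_def)

text \<open>Unlike \<open>mutseq\<close> this starts from an arbitrary state, so that the tail of a
  path can be read from a later cluster.\<close>

definition run :: "seed \<Rightarrow> mstate \<Rightarrow> nat list \<Rightarrow> mstate" where
  "run S st ks = foldl (\<lambda>st k. mutate S k st) st ks"

lemma run_Nil [simp]: "run S st [] = st"
  and run_Cons [simp]: "run S st (k # ks) = run S (mutate S k st) ks"
  by (simp_all add: run_def)

lemma cvar_eq: "cvar S ks y = fst (run S (Xvar, bmat S) ks) y"
  by (simp add: cvar_def mutseq_def init_state_def run_def)

lemma run_cong_allv: "allv S = allv T \<Longrightarrow> run S st ks = run T st ks"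
proof (induction ks arbitrary: st)
  case (Cons k ks)
  have "mutate S k st = mutate T k st"
    using Cons.prems by (simp add: mutate_def)
  with Cons show ?case by simp
qed simp

lemma positive_exch: "(\<And>y. y \<in> A \<Longrightarrow> positive (v y)) \<Longrightarrow> positive (exch A B k v)"
  unfolding exch_def by (intro positive_add positive_monomial) auto

lemma evaluates_exch:
  "(\<And>y. y \<in> A \<Longrightarrow> evaluates \<phi> (v y) (w y)) \<Longrightarrow> evaluates \<phi> (exch A B k v) (exch A B k w)"
  unfolding exch_def by (intro evaluates_add evaluates_monomial) auto

text \<open>Mutation commutes with substitution, because positivity keeps every value that is
  divided by away from zero.\<close>

lemma evaluates_run:
  assumes "\<And>y. evaluates v (w y) (u y)" "\<And>y. positive (u y)"
  shows "evaluates v (fst (run S (w, B) ks) y) (fst (run S (u, B) ks) y)"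
  using assms
proof (induction ks arbitrary: w u B y)
  case (Cons k ks)
  have "evaluates v ((w(k := exch (allv S) B k w / w k)) y) ((u(k := exch (allv S) B k u / u k)) y)" for y
    using Cons.prems positive_nonzero[OF Cons.prems(2)[of k]]
    by (auto intro!: evaluates_divide evaluates_exch)
  moreover have "positive ((u(k := exch (allv S) B k u / u k)) y)" for y
    using Cons.prems by (auto intro!: positive_divide positive_exch)
  ultimately show ?case using Cons.IH by (simp add: mutate_eq)
qed simp

lemma evaluates_cvar:
  assumes "\<And>y. positive (v y)"
  shows "evaluates v (cvar S ks y) (fst (run S (v, bmat S) ks) y)"
  unfolding cvar_eq by (rule evaluates_run[OF evaluates_Xvar assms])

text \<open>The division is exact: for equal nonzero signs the numerator is plus or minus twice the
  product, otherwise it is \<open>0\<close>.\<close>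

lemma mutation_term_div:
  "(\<bar>b\<bar> * c + b * \<bar>c\<bar>) div 2 = (if b > 0 \<and> c > 0 then b * c else if b < 0 \<and> c < 0 then - (b * c) else (0::int))"
proof -
  consider "b > 0 \<and> c > 0" | "b < 0 \<and> c < 0" | "b = 0 \<or> c = 0" | "b > 0 \<and> c < 0" | "b < 0 \<and> c > 0"
    by linarith
  then show ?thesis
    by cases auto
qed

lemma matrix_mutation_eq:
  "matrix_mutation k B y z = (if y = k \<or> z = k then - B y z
     else B y z + (if B y k > 0 \<and> B k z > 0 then B y k * B k z
       else if B y k < 0 \<and> B k z < 0 then - (B y k * B k z) else 0))"
  unfolding matrix_mutation_def mutation_term_div ..

text \<open>Mutation negates row and column \<open>k\<close>, hence also the correction term, so the
  second correction cancels the first.\<close>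

lemma matrix_mutation_involutive: "matrix_mutation k (matrix_mutation k B) = B"
proof (intro ext)
  fix y z
  show "matrix_mutation k (matrix_mutation k B) y z = B y z"
  proof (cases "y = k \<or> z = k")
    case False
    then have "matrix_mutation k B y k = - B y k" "matrix_mutation k B k z = - B k z"
      by (simp_all add: matrix_mutation_def)
    then have "matrix_mutation k (matrix_mutation k B) y z
        = matrix_mutation k B y z + (\<bar>- B y k\<bar> * - B k z + - B y k * \<bar>- B k z\<bar>) div 2"
      using False by (simp only: matrix_mutation_def[of k "matrix_mutation k B"] if_False)
    moreover have "matrix_mutation k B y z = B y z + (\<bar>B y k\<bar> * B k z + B y k * \<bar>B k z\<bar>) div 2"
      using False by (simp add: matrix_mutation_def)
    ultimately show ?thesis
      unfolding mutation_term_div by simp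
  qed (auto simp: matrix_mutation_def)
qed

text \<open>Column \<open>k\<close> changes sign, which swaps the two monomials, and the variable at
  \<open>k\<close> does not occur because \<open>B k k = 0\<close>.\<close>

lemma exch_matrix_mutation:
  assumes "B k k = 0"
  shows "exch A (matrix_mutation k B) k (v(k := c)) = exch A B k v"
proof -
  have "(\<Prod>y\<in>{y \<in> A. B y k > 0}. (v(k := c)) y ^ nat (B y k)) = (\<Prod>y\<in>{y \<in> A. B y k > 0}. v y ^ nat (B y k))"
    by (rule prod.cong) (use assms in auto)
  moreover have "(\<Prod>y\<in>{y \<in> A. B y k < 0}. (v(k := c)) y ^ nat (- B y k)) = (\<Prod>y\<in>{y \<in> A. B y k < 0}. v y ^ nat (- B y k))"
    by (rule prod.cong) (use assms in auto)
  ultimately show ?thesis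
    by (simp add: exch_def matrix_mutation_eq add.commute)
qed

lemma mutate_involutive:
  assumes "B k k = 0" "\<And>y. positive (v y)"
  shows "mutate S k (mutate S k (v, B)) = (v, B)"
proof -
  have "exch (allv S) B k v \<noteq> 0" "v k \<noteq> 0"
    using assms(2) by (auto intro!: positive_nonzero positive_exch)
  then show ?thesis
    by (simp add: mutate_eq exch_matrix_mutation assms(1) matrix_mutation_involutive)
qed

section \<open>Valid exchange matrices and their mutation\<close>

definition valid_matrix :: "nat set \<Rightarrow> nat set \<Rightarrow> (nat \<Rightarrow> nat \<Rightarrow> int) \<Rightarrow> bool" where
  "valid_matrix I A B \<longleftrightarrow>
     (\<forall>z\<in>I. finite {y \<in> A. B y z \<noteq> 0}) \<and> (\<forall>y\<in>A. finite {z \<in> I. B y z \<noteq> 0}) \<and>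
     (\<exists>d :: nat \<Rightarrow> int. (\<forall>k\<in>I. d k > 0) \<and> (\<forall>i\<in>I. \<forall>j\<in>I. d i * B i j = - (d j * B j i)))"

lemma valid_seed_eq:
  "valid_seed S \<longleftrightarrow> exv S \<inter> frv S = {} \<and> valid_matrix (exv S) (allv S) (bmat S)"
  by (simp add: valid_seed_def valid_matrix_def)

lemma valid_matrix_sgn:
  assumes "valid_matrix I A B" "i \<in> I" "j \<in> I"
  shows "sgn (B i j) = - sgn (B j i)"
proof -
  obtain d :: "nat \<Rightarrow> int" where d: "\<forall>k\<in>I. d k > 0" "\<forall>i\<in>I. \<forall>j\<in>I. d i * B i j = - (d j * B j i)"
    using assms(1) unfolding valid_matrix_def by blast
  have "sgn (d i * B i j) = sgn (- (d j * B j i))"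
    using d assms by metis
  then show ?thesis
    using d(1) assms by (simp add: sgn_mult sgn_minus)
qed

lemma valid_matrix_diag: "valid_matrix I A B \<Longrightarrow> i \<in> I \<Longrightarrow> B i i = 0"
  using valid_matrix_sgn[of I A B i i] by (simp add: sgn_if split: if_splits)

text \<open>The old symmetrizer \<open>d\<close> still works. A new column is supported on the union
  of two old columns, a new row on the union of two old rows, so local finiteness survives.\<close>

lemma valid_matrix_mutation:
  assumes "valid_matrix I A B" "k \<in> I" "I \<subseteq> A"
  shows "valid_matrix I A (matrix_mutation k B)"
  unfolding valid_matrix_def
proof (intro conjI ballI)
  fix z assume z: "z \<in> I"
  have "{y \<in> A. matrix_mutation k B y z \<noteq> 0} \<subseteq> {y \<in> A. B y z \<noteq> 0} \<union> {y \<in> A. B y k \<noteq> 0}"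
    by (auto simp: matrix_mutation_eq split: if_splits)
  moreover have "finite ({y \<in> A. B y z \<noteq> 0} \<union> {y \<in> A. B y k \<noteq> 0})"
    using assms z unfolding valid_matrix_def by blast
  ultimately show "finite {y \<in> A. matrix_mutation k B y z \<noteq> 0}"
    by (rule finite_subset)
next
  fix y assume y: "y \<in> A"
  have "{z \<in> I. matrix_mutation k B y z \<noteq> 0} \<subseteq> {z \<in> I. B y z \<noteq> 0} \<union> {z \<in> I. B k z \<noteq> 0}"
    by (auto simp: matrix_mutation_eq split: if_splits)
  moreover have "finite ({z \<in> I. B y z \<noteq> 0} \<union> {z \<in> I. B k z \<noteq> 0})"
    using assms y unfolding valid_matrix_def by blast
  ultimately show "finite {z \<in> I. matrix_mutation k B y z \<noteq> 0}"
    by (rule finite_subset)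
next
  obtain d :: "nat \<Rightarrow> int" where d: "\<forall>k\<in>I. d k > 0" "\<forall>i\<in>I. \<forall>j\<in>I. d i * B i j = - (d j * B j i)"
    using assms(1) unfolding valid_matrix_def by blast
  have "d i * matrix_mutation k B i j = - (d j * matrix_mutation k B j i)" if "i \<in> I" "j \<in> I" for i j
  proof -
    have eq2: "d i * B i j = - (d j * B j i)"
      using d(2) that by blast
    show ?thesis
    proof (cases "i = k \<or> j = k")
      case True
      then show ?thesis using eq2 by (auto simp: matrix_mutation_def)
    next
      case False
      have sg: "sgn (B i k) = - sgn (B k i)" "sgn (B j k) = - sgn (B k j)"
        using valid_matrix_sgn assms that by metis+
      have "d i * (B i k * B k j) = - (d k * B k i) * B k j"
        using d(2) that assms(2) by (metis mult.assoc)
      also have "\<dots> = - (d k * B k j) * B k i"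
        by simp
      also have "\<dots> = d j * (B j k * B k i)"
        using d(2) that assms(2) by (metis mult.assoc)
      finally have eq: "d i * (B i k * B k j) = d j * (B j k * B k i)" .
      have "d i * (matrix_mutation k B i j - B i j) = - (d j * (matrix_mutation k B j i - B j i))"
      proof -
        \<comment> \<open>By sign-skewness a nonzero correction at \<open>(i, j)\<close> occurs
          exactly when one at \<open>(j, i)\<close> does, with the opposite sign.\<close>
        consider "B i k > 0 \<and> B k j > 0" "B j k < 0 \<and> B k i < 0" | "B i k < 0 \<and> B k j < 0" "B j k > 0 \<and> B k i > 0"
          | "\<not> (B i k > 0 \<and> B k j > 0)" "\<not> (B i k < 0 \<and> B k j < 0)"
            "\<not> (B j k > 0 \<and> B k i > 0)" "\<not> (B j k < 0 \<and> B k i < 0)"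
          using sg by (auto simp: sgn_if split: if_splits)
        then show ?thesis
          by cases (use False eq in \<open>auto simp: matrix_mutation_eq\<close>)
      qed
      with eq2 show ?thesis by (simp add: right_diff_distrib)
    qed
  qed
  with d(1) show "\<exists>d :: nat \<Rightarrow> int. (\<forall>k\<in>I. d k > 0) \<and>
      (\<forall>i\<in>I. \<forall>j\<in>I. d i * matrix_mutation k B i j = - (d j * matrix_mutation k B j i))"
    by blast
qed

lemma exch_superset:
  assumes "finite F" "F \<subseteq> A" "{y \<in> A. B y k \<noteq> 0} \<subseteq> F"
  shows "exch A B k v = (\<Prod>y\<in>F. v y ^ nat (B y k)) + (\<Prod>y\<in>F. v y ^ nat (- B y k))"
proof -
  have "(\<Prod>y\<in>{y \<in> A. B y k > 0}. v y ^ nat (B y k)) = (\<Prod>y\<in>F. v y ^ nat (B y k))"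
  proof (rule prod.mono_neutral_left)
    show "\<forall>y\<in>F - {y \<in> A. B y k > 0}. v y ^ nat (B y k) = 1"
    proof
      fix y assume "y \<in> F - {y \<in> A. B y k > 0}"
      then have "nat (B y k) = 0" using assms(2) by auto
      then show "v y ^ nat (B y k) = 1" by simp
    qed
  qed (use assms in auto)
  moreover have "(\<Prod>y\<in>{y \<in> A. B y k < 0}. v y ^ nat (- B y k)) = (\<Prod>y\<in>F. v y ^ nat (- B y k))"
  proof (rule prod.mono_neutral_left)
    show "\<forall>y\<in>F - {y \<in> A. B y k < 0}. v y ^ nat (- B y k) = 1"
    proof
      fix y assume "y \<in> F - {y \<in> A. B y k < 0}"
      then have "nat (- B y k) = 0" using assms(2) by auto
      then show "v y ^ nat (- B y k) = 1" by simp
    qed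
  qed (use assms in auto)
  ultimately show ?thesis by (simp add: exch_def)
qed

lemma exch_laurent_ring:
  assumes "\<And>y. y \<in> A \<Longrightarrow> v y \<in> laurent_ring I A' u"
  shows "exch A B k v \<in> laurent_ring I A' u"
  unfolding exch_def by (intro laurent_ring.add laurent_ring_prod laurent_ring_power) (use assms in auto)

section \<open>Divisibility in Laurent rings\<close>

text \<open>A variable occurs in at most one of the two monomials, so setting it to \<open>0\<close>
  kills at most one of them. The first claim will show that no variable divides an exchange
  polynomial; the second detects the variables that occur in it.\<close>

lemma exch_zero_subst:
  assumes fin: "finite {y \<in> A. B y k \<noteq> 0}"
  shows "positive (exch A B k (Xvar(i := 0)))"
    and "i \<in> A \<Longrightarrow> B i k \<noteq> 0 \<Longrightarrow> exch A B k (Xvar(i := 0)) \<noteq> exch A B k Xvar"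
proof -
  define P where "P = (\<Prod>y\<in>{y \<in> A. B y k > 0}. Xvar y ^ nat (B y k))"
  define N where "N = (\<Prod>y\<in>{y \<in> A. B y k < 0}. Xvar y ^ nat (- B y k))"
  define P0 where "P0 = (\<Prod>y\<in>{y \<in> A. B y k > 0}. (Xvar(i := 0)) y ^ nat (B y k))"
  define N0 where "N0 = (\<Prod>y\<in>{y \<in> A. B y k < 0}. (Xvar(i := 0)) y ^ nat (- B y k))"
  have pos: "positive P" "positive N"
    unfolding P_def N_def by (intro positive_monomial positive_Xvar)+
  have P0: "P0 = (if i \<in> A \<and> B i k > 0 then 0 else P)"
  proof (cases "i \<in> A \<and> B i k > 0")
    case True
    \<comment> \<open>Finiteness matters here: an infinite product is \<open>1\<close> by convention
      and would not vanish.\<close>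
    have "finite {y \<in> A. B y k > 0}"
      by (rule finite_subset[OF _ fin]) auto
    then have "P0 = 0"
      unfolding P0_def by (rule prod_zero) (use True in auto)
    with True show ?thesis by simp
  next
    case False
    then have "P0 = P"
      unfolding P0_def P_def by (intro prod.cong) auto
    with False show ?thesis by auto
  qed
  have N0: "N0 = (if i \<in> A \<and> B i k < 0 then 0 else N)"
  proof (cases "i \<in> A \<and> B i k < 0")
    case True
    have "finite {y \<in> A. B y k < 0}"
      by (rule finite_subset[OF _ fin]) auto
    then have "N0 = 0"
      unfolding N0_def by (rule prod_zero) (use True in auto)
    with True show ?thesis by simp
  next
    case False
    then have "N0 = N"
      unfolding N0_def N_def by (intro prod.cong) auto
    with False show ?thesis by auto
  qed
  have eq: "exch A B k Xvar = P + N" "exch A B k (Xvar(i := 0)) = P0 + N0"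
    by (simp_all add: exch_def P_def N_def P0_def N0_def)
  show "positive (exch A B k (Xvar(i := 0)))"
    using pos by (auto simp: eq P0 N0 intro: positive_add)
  show "exch A B k (Xvar(i := 0)) \<noteq> exch A B k Xvar" if "i \<in> A" "B i k \<noteq> 0"
    using that pos[THEN positive_nonzero] by (auto simp: eq P0 N0)
qed

text \<open>Rewrites an expression in the cluster \<open>v\<close> over the cluster \<open>u\<close>
  at the cost of a power of one common denominator \<open>q\<close>.\<close>

lemma laurent_ring_clear_denominators:
  assumes "z \<in> laurent_ring I A v" "q \<in> laurent_ring I' A' u"
    and "\<And>k. k \<in> A \<Longrightarrow> v k \<in> laurent_ring I' A' u"
    and "\<And>k. k \<in> I \<Longrightarrow> \<exists>n. inverse (v k) * q ^ n \<in> laurent_ring I' A' u"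
  shows "\<exists>n. z * q ^ n \<in> laurent_ring I' A' u"
  using assms(1)
proof induction
  case (const c)
  then show ?case by (intro exI[of _ 0]) (simp add: laurent_ring.const)
next
  case (var k)
  then show ?case using assms(3) by (intro exI[of _ 0]) simp
next
  case (inv k)
  then show ?case using assms(4) by blast
next
  case (add a b)
  then obtain m n where mn: "a * q ^ m \<in> laurent_ring I' A' u" "b * q ^ n \<in> laurent_ring I' A' u"
    by blast
  have "(a * q ^ m) * q ^ n + (b * q ^ n) * q ^ m \<in> laurent_ring I' A' u"
    by (intro laurent_ring.add mn[THEN laurent_ring.mult] laurent_ring_power assms(2))
  then show ?case
    by (intro exI[of _ "m + n"]) (simp add: power_add algebra_simps)
next
  case (mult a b)
  then obtain m n where mn: "a * q ^ m \<in> laurent_ring I' A' u" "b * q ^ n \<in> laurent_ring I' A' u"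
    by blast
  have "(a * q ^ m) * (b * q ^ n) \<in> laurent_ring I' A' u"
    by (rule laurent_ring.mult[OF mn])
  then show ?case
    by (intro exI[of _ "m + n"]) (simp add: power_add algebra_simps)
qed

lemma laurent_ring_clear_frozen:
  assumes "z \<in> laurent_ring A A Xvar"
  shows "\<exists>ys. set ys \<subseteq> A - I \<and> z * prod_list (map Xvar ys) \<in> laurent_ring I A Xvar"
  using assms
proof induction
  case (const c)
  then show ?case by (intro exI[of _ "[]"]) (simp add: laurent_ring.const)
next
  case (var k)
  then show ?case by (intro exI[of _ "[]"]) (simp add: laurent_ring.var)
next
  case (inv k)
  show ?case
  proof (cases "k \<in> I")
    case True
    then show ?thesis by (intro exI[of _ "[]"]) (simp add: laurent_ring.inv)
  next
    case False
    with inv show ?thesis by (intro exI[of _ "[k]"]) (simp add: laurent_ring_1)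
  qed
next
  case (add a b)
  then obtain xs ys where *: "set xs \<subseteq> A - I" "set ys \<subseteq> A - I"
    "a * prod_list (map Xvar xs) \<in> laurent_ring I A Xvar" "b * prod_list (map Xvar ys) \<in> laurent_ring I A Xvar"
    by blast
  have "prod_list (map Xvar zs) \<in> laurent_ring I A Xvar" if "set zs \<subseteq> A - I" for zs
    using that by (induction zs) (auto intro: laurent_ring.intros laurent_ring_1)
  with * have "(a * prod_list (map Xvar xs)) * prod_list (map Xvar ys)
      + (b * prod_list (map Xvar ys)) * prod_list (map Xvar xs) \<in> laurent_ring I A Xvar"
    by (intro laurent_ring.add *(3,4)[THEN laurent_ring.mult])
  with * show ?case
    by (intro exI[of _ "xs @ ys"]) (simp add: algebra_simps)
next
  case (mult a b)
  then obtain xs ys where *: "set xs \<subseteq> A - I" "set ys \<subseteq> A - I"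
    "a * prod_list (map Xvar xs) \<in> laurent_ring I A Xvar" "b * prod_list (map Xvar ys) \<in> laurent_ring I A Xvar"
    by blast
  have "(a * prod_list (map Xvar xs)) * (b * prod_list (map Xvar ys)) \<in> laurent_ring I A Xvar"
    by (rule laurent_ring.mult[OF *(3,4)])
  with * show ?case
    by (intro exI[of _ "xs @ ys"]) (simp add: algebra_simps)
qed

text \<open>Replacing \<open>Xvar i\<close> by something congruent to it modulo \<open>p\<close>
  changes a Laurent polynomial only by a multiple of \<open>p\<close>. Used with \<open>p\<close> a
  frozen variable set to \<open>0\<close>, and with \<open>p\<close> linear in
  \<open>Xvar i\<close>, which is replaced by the root.\<close>

lemma laurent_ring_subst_congruent:
  assumes "z \<in> laurent_ring I A Xvar" "p \<in> laurent_ring I A Xvar"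
    and "\<phi> i \<in> laurent_ring I A Xvar" "\<exists>c\<in>laurent_ring I A Xvar. Xvar i - \<phi> i = p * c"
    and "i \<in> I \<Longrightarrow> \<phi> i \<noteq> 0 \<and> inverse (\<phi> i) \<in> laurent_ring I A Xvar"
    and "\<And>y. y \<noteq> i \<Longrightarrow> \<phi> y = Xvar y"
  shows "\<exists>w\<in>laurent_ring I A Xvar. evaluates \<phi> z w \<and> (\<exists>c\<in>laurent_ring I A Xvar. z - w = p * c)"
  using assms(1)
proof induction
  case (const q)
  show ?case
    by (intro bexI[of _ "qconst q"] conjI bexI[of _ 0])
       (use evaluates_qconst[of \<phi> q] in \<open>auto simp: of_rat_eq_qconst laurent_ring_0 laurent_ring.const\<close>)
next
  case (var k)
  show ?case
  proof (cases "k = i")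
    case True
    then show ?thesis using assms(3,4) evaluates_Xvar by metis
  next
    case False
    have "evaluates \<phi> (Xvar k) (Xvar k)"
      using evaluates_Xvar[of \<phi> k] assms(6)[OF False] by simp
    then show ?thesis
      using var by (intro bexI[of _ "Xvar k"] conjI bexI[of _ 0]) (auto simp: laurent_ring_0 laurent_ring.var)
  qed
next
  case (inv k)
  show ?case
  proof (cases "k = i")
    case True
    obtain c where c: "c \<in> laurent_ring I A Xvar" "Xvar i - \<phi> i = p * c"
      using assms(4) by blast
    have *: "\<phi> i \<noteq> 0" "inverse (\<phi> i) \<in> laurent_ring I A Xvar" "inverse (Xvar i) \<in> laurent_ring I A Xvar"
      using assms(5) inv True by (auto intro: laurent_ring.inv)
    have "inverse (Xvar i) - inverse (\<phi> i) = - (inverse (Xvar i) * (Xvar i - \<phi> i) * inverse (\<phi> i))"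
      using * by (simp add: inverse_diff_inverse)
    then have "inverse (Xvar i) - inverse (\<phi> i) = p * - (inverse (Xvar i) * c * inverse (\<phi> i))"
      by (simp add: c(2))
    moreover have "- (inverse (Xvar i) * c * inverse (\<phi> i)) \<in> laurent_ring I A Xvar"
      by (intro laurent_ring_uminus laurent_ring.mult * c)
    ultimately show ?thesis
      using * True evaluates_inverse[OF evaluates_Xvar[of \<phi> i]] by blast
  next
    case False
    have "evaluates \<phi> (inverse (Xvar k)) (inverse (Xvar k))"
      using evaluates_inverse[OF evaluates_Xvar[of \<phi> k]] assms(6)[OF False] by simp
    then show ?thesis
      using inv by (intro bexI[of _ "inverse (Xvar k)"] conjI bexI[of _ 0]) (auto simp: laurent_ring_0 laurent_ring.inv)
  qed
next
  case (add a b)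
  then obtain v w c d where *: "v \<in> laurent_ring I A Xvar" "w \<in> laurent_ring I A Xvar"
    "c \<in> laurent_ring I A Xvar" "d \<in> laurent_ring I A Xvar"
    "evaluates \<phi> a v" "evaluates \<phi> b w" "a - v = p * c" "b - w = p * d"
    by blast
  have "a + b - (v + w) = (a - v) + (b - w)"
    by simp
  then have "a + b - (v + w) = p * (c + d)"
    by (simp only: * distrib_left)
  with * show ?case
    using evaluates_add laurent_ring.add by blast
next
  case (mult a b)
  then obtain v w c d where *: "v \<in> laurent_ring I A Xvar" "w \<in> laurent_ring I A Xvar"
    "c \<in> laurent_ring I A Xvar" "d \<in> laurent_ring I A Xvar"
    "evaluates \<phi> a v" "evaluates \<phi> b w" "a - v = p * c" "b - w = p * d"
    by blast
  have "a * b - v * w = a * (b - w) + (a - v) * w"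
    by (simp add: algebra_simps)
  then have "a * b - v * w = p * (a * d + c * w)"
    by (simp only: *) (simp add: algebra_simps)
  moreover have "a * d + c * w \<in> laurent_ring I A Xvar"
    using * mult by (intro laurent_ring.add laurent_ring.mult)
  ultimately show ?case
    using * evaluates_mult laurent_ring.mult by metis
qed

text \<open>By the last hypothesis a frozen variable does not divide \<open>p\<close>, so
  multiplying by \<open>p ^ n\<close> cannot remove it from the denominator of \<open>z\<close>;
  hence it was not there.\<close>

lemma laurent_ring_frozen_polynomial:
  assumes "z \<in> laurent_ring A A Xvar" "z * p ^ n \<in> laurent_ring I A Xvar" "p \<in> laurent_ring I A Xvar"
    and "\<And>y. y \<in> A - I \<Longrightarrow> \<exists>w. evaluates (Xvar(y := 0)) p w \<and> w \<noteq> 0"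
  shows "z \<in> laurent_ring I A Xvar"
proof -
  have step: "u \<in> laurent_ring I A Xvar"
    if u: "u * Xvar y \<in> laurent_ring I A Xvar" "u * p ^ n \<in> laurent_ring I A Xvar" and y: "y \<in> A - I" for u y
  proof -
    let ?\<phi> = "Xvar(y := 0)"
    have "\<exists>w\<in>laurent_ring I A Xvar. evaluates ?\<phi> (u * Xvar y) w \<and>
        (\<exists>c\<in>laurent_ring I A Xvar. u * Xvar y - w = Xvar y * c)"
      using y by (intro laurent_ring_subst_congruent[where i = y] u laurent_ring.var bexI[of _ 1])
        (auto simp: laurent_ring_0 laurent_ring_1)
    then obtain w c where w: "evaluates ?\<phi> (u * Xvar y) w"
      and c: "c \<in> laurent_ring I A Xvar" "u * Xvar y - w = Xvar y * c"
      by blast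
    obtain t where t: "evaluates ?\<phi> p t" "t \<noteq> 0"
      using assms(4) y by blast
    have "\<exists>s. evaluates ?\<phi> (u * p ^ n) s"
    proof (rule evaluates_laurent_ring[OF u(2)])
      show "evaluates ?\<phi> (Xvar k) (?\<phi> k)" for k
        by (rule evaluates_Xvar)
    qed (use y in auto)
    then obtain s where s: "evaluates ?\<phi> (u * p ^ n) s" by blast
    \<comment> \<open>The product of \<open>u\<close>, \<open>Xvar y\<close> and
      \<open>p ^ n\<close> has value \<open>w * t ^ n\<close> computed from
      \<open>u * Xvar y\<close>, but \<open>0\<close> computed from \<open>u * p ^ n\<close>. Hence
      \<open>w = 0\<close>, and \<open>u\<close> is the quotient \<open>c\<close>, which lies in the
      ring.\<close>
    have "evaluates ?\<phi> ((u * Xvar y) * p ^ n) (w * t ^ n)"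
      by (intro evaluates_mult evaluates_power w t)
    then have "evaluates ?\<phi> ((u * p ^ n) * Xvar y) (w * t ^ n)"
      by (simp only: ac_simps)
    moreover have "evaluates ?\<phi> ((u * p ^ n) * Xvar y) (s * 0)"
      using evaluates_mult[OF s evaluates_Xvar[of ?\<phi> y]] by simp
    ultimately have "w * t ^ n = s * 0"
      by (rule evaluates_unique)
    then have "w = 0"
      using t(2) by simp
    with c(2) have "u = c"
      by simp
    with c(1) show ?thesis by simp
  qed
  obtain ys where ys: "set ys \<subseteq> A - I" "z * prod_list (map Xvar ys) \<in> laurent_ring I A Xvar"
    using laurent_ring_clear_frozen[OF assms(1)] by blast
  then show ?thesis
  proof (induction ys)
    case (Cons y ys)
    have "prod_list (map Xvar ys) \<in> laurent_ring I A Xvar"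
      using Cons.prems(1) by (induction ys) (auto intro: laurent_ring.intros laurent_ring_1)
    then have "(z * p ^ n) * prod_list (map Xvar ys) \<in> laurent_ring I A Xvar"
      by (rule laurent_ring.mult[OF assms(2)])
    then have *: "(z * prod_list (map Xvar ys)) * p ^ n \<in> laurent_ring I A Xvar"
      by (simp only: ac_simps)
    have "(z * prod_list (map Xvar ys)) * Xvar y \<in> laurent_ring I A Xvar"
      using Cons.prems(2) by (simp only: ac_simps list.map prod_list.Cons)
    from step[OF this *] Cons.prems(1) have "z * prod_list (map Xvar ys) \<in> laurent_ring I A Xvar"
      by simp
    with Cons show ?case by simp
  qed simp
qed

text \<open>Substituting the root of \<^term>\<open>p\<close>, which is linear in the \<^term>\<open>i\<close>-th variable, is the
  reduction modulo \<^term>\<open>p\<close> and has values in a domain.  The point \<^term>\<open>\<theta>\<close> is a rational zero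
  of \<^term>\<open>p\<close> witnessing that \<^term>\<open>p\<close> does not divide \<^term>\<open>q\<close>.\<close>

lemma prime_linear_polynomial:
  fixes \<theta> :: "nat \<Rightarrow> rat" and A :: "nat set"
  defines "L \<equiv> laurent_ring A A Xvar"
  assumes M: "M = (\<Prod>y\<in>F. Xvar y ^ m y)" and N: "N = (\<Prod>y\<in>F. Xvar y ^ n y)"
    and F: "F \<subseteq> A" "i \<in> A" "i \<notin> F" and p: "p = Xvar i * M + N"
    and \<theta>: "\<And>y. y \<in> A \<Longrightarrow> \<theta> y \<noteq> 0" "evaluates \<theta> p 0" "evaluates \<theta> q t" "t \<noteq> 0"
    and qh: "q \<in> L" "h \<in> L" "c \<in> L" "q * h = p * c"
  shows "\<exists>c\<in>L. h = p * c"
proof -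
  define \<phi> where "\<phi> = Xvar(i := - N / M)"
  have nz: "M \<noteq> 0" "N \<noteq> 0"
    unfolding M N by (intro positive_nonzero positive_monomial positive_Xvar)+
  have mon: "M \<in> L" "N \<in> L"
    unfolding M N L_def using F(1) by (intro laurent_ring_monomial; assumption)+
  have inv: "inverse M \<in> L" "inverse N \<in> L"
    unfolding M N L_def prod_inversef[symmetric] comp_def power_inverse
    using F(1) by (auto intro!: laurent_ring_prod laurent_ring_power laurent_ring.inv
      simp flip: power_inverse)
  have Xi: "Xvar i \<in> L"
    unfolding L_def using F(2) by (rule laurent_ring.var)
  have pL: "p \<in> L"
    unfolding p using mon Xi unfolding L_def by (intro laurent_ring.add laurent_ring.mult)
  have \<phi>i: "\<phi> i = - (N * inverse M)" "inverse (\<phi> i) = - (M * inverse N)"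
    by (simp_all add: \<phi>_def divide_inverse inverse_mult_distrib mult.commute)
  have cong: "\<exists>w\<in>L. evaluates \<phi> z w \<and> (\<exists>c\<in>L. z - w = p * c)" if "z \<in> L" for z
    unfolding L_def
  proof (rule laurent_ring_subst_congruent[where i = i])
    show "\<phi> i \<in> laurent_ring A A Xvar"
      unfolding \<phi>i using mon inv unfolding L_def by (intro laurent_ring_uminus laurent_ring.mult)
    \<comment> \<open>\<open>M\<close> is a monomial, hence a unit of \<open>L\<close>, so the
      variable and the root of \<open>p\<close> agree modulo \<open>p\<close>.\<close>
    have "Xvar i - \<phi> i = p * inverse M"
      using nz by (simp add: \<phi>i p distrib_right)
    with inv show "\<exists>c\<in>laurent_ring A A Xvar. Xvar i - \<phi> i = p * c"
      unfolding L_def by blast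
    have "\<phi> i \<noteq> 0"
      using nz by (simp add: \<phi>_def)
    moreover have "inverse (\<phi> i) \<in> laurent_ring A A Xvar"
      using laurent_ring_uminus[OF laurent_ring.mult[OF mon(1)[unfolded L_def] inv(2)[unfolded L_def]]]
      unfolding \<phi>i(2) .
    ultimately show "\<phi> i \<noteq> 0 \<and> inverse (\<phi> i) \<in> laurent_ring A A Xvar" ..
  qed (use that pL in \<open>auto simp: L_def \<phi>_def\<close>)
  have ev_mon: "evaluates \<phi> (\<Prod>y\<in>F. Xvar y ^ e y) (\<Prod>y\<in>F. Xvar y ^ e y)" for e
  proof -
    have "evaluates \<phi> (Xvar y) (Xvar y)" if "y \<in> F" for y
      using that F(3) evaluates_Xvar[of \<phi> y] by (auto simp: \<phi>_def split: if_splits)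
    then show ?thesis by (rule evaluates_monomial)
  qed
  have "evaluates \<phi> p (\<phi> i * M + N)"
    unfolding p by (intro evaluates_add evaluates_mult evaluates_Xvar) (simp_all only: M N ev_mon)
  then have \<phi>p: "evaluates \<phi> p 0"
    using nz by (simp add: \<phi>_def)
  obtain w u where w: "evaluates \<phi> q w" "u \<in> L" "q - w = p * u"
    using cong[OF qh(1)] by blast
  obtain w' u' where w': "evaluates \<phi> h w'" "u' \<in> L" "h - w' = p * u'"
    using cong[OF qh(2)] by blast
  obtain s where "evaluates \<phi> c s"
    using cong[OF qh(3)] by blast
  then have "evaluates \<phi> (p * c) (0 * s)"
    by (rule evaluates_mult[OF \<phi>p])
  moreover have "evaluates \<phi> (q * h) (w * w')"
    using w w' by (intro evaluates_mult)
  ultimately have "w * w' = 0"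
    using qh(4) evaluates_unique by fastforce
  moreover have "w \<noteq> 0"
  proof
    assume "w = 0"
    have "\<exists>r. evaluates \<theta> u r"
      using w(2) \<theta>(1) unfolding L_def
      by (intro evaluates_laurent_ring[of _ _ _ _ _ \<theta>]) (auto intro: evaluates_Xvar)
    then obtain r where "evaluates \<theta> u r" by blast
    then have "evaluates \<theta> (p * u) (0 * r)"
      by (rule evaluates_mult[OF \<theta>(2)])
    then have "evaluates \<theta> q 0"
      using w(3) \<open>w = 0\<close> by simp
    with \<theta>(3,4) evaluates_unique show False by metis
  qed
  ultimately show ?thesis
    using w' by auto
qed

section \<open>Three consecutive mutations in two directions\<close>

text \<open>With the next lemma: clusters do not notice a global sign change of the matrix, which
  later settles the case \<open>B j k > 0\<close>.\<close>

lemma exch_uminus: "exch A (\<lambda>y z. - B y z) k v = exch A B k v"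
  by (simp add: exch_def add.commute)

lemma matrix_mutation_uminus:
  "matrix_mutation k (\<lambda>y z. - B y z) = (\<lambda>y z. - matrix_mutation k B y z)"
  by (intro ext) (auto simp: matrix_mutation_eq)

text \<open>The point of these formulas is the vanishing order along the first exchange polynomial, that
  is, along \<^term>\<open>x1\<close>.  For \<^term>\<open>b > 1\<close> the last variable \<^term>\<open>xj\<close> is a monomial modulo
  \<^term>\<open>x1\<close>; for \<^term>\<open>b = 1\<close> there is a second monomial, free of the \<^term>\<open>j\<close>-th variable.\<close>

lemma rank_two_mutation:
  fixes B :: "nat \<Rightarrow> nat \<Rightarrow> int" and A j k
  defines "v1 \<equiv> Xvar(j := exch A B j Xvar / Xvar j)" and "B1 \<equiv> matrix_mutation j B"
  defines "v2 \<equiv> v1(k := exch A B1 k v1 / v1 k)" and "B2 \<equiv> matrix_mutation k B1"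
  defines "x1 \<equiv> v1 j" and "xk \<equiv> v2 k" and "xj \<equiv> exch A B2 j v2 / v2 j"
  defines "b \<equiv> nat (- B j k)" and "c \<equiv> nat (B k j)"
  assumes jk: "j \<in> A" "k \<in> A" "j \<noteq> k" "B j j = 0" "B k k = 0" "B j k < 0" "B k j > 0"
    and fin: "finite {y \<in> A. B y j \<noteq> 0}" "finite {y \<in> A. B y k \<noteq> 0}"
  obtains G m1 u w and g :: "nat \<Rightarrow> nat" where "finite G" "G \<subseteq> A - {j, k}" "\<forall>y\<in>A - {j, k}. B y j \<noteq> 0 \<longrightarrow> y \<in> G"
    "xk = (x1 ^ b * (\<Prod>y\<in>G. Xvar y ^ u y) + (\<Prod>y\<in>G. Xvar y ^ g y)) / Xvar k"
    "xj = ((\<Prod>y\<in>G. Xvar y ^ m1 y) * (\<Prod>y\<in>G. Xvar y ^ u y) * x1 ^ (b - 1)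
        * (\<Sum>i<c. (\<Prod>y\<in>G. Xvar y ^ g y) ^ (c - Suc i) * (x1 ^ b * (\<Prod>y\<in>G. Xvar y ^ u y) + (\<Prod>y\<in>G. Xvar y ^ g y)) ^ i)
        + (\<Prod>y\<in>G. Xvar y ^ w y) * Xvar j) / Xvar k ^ c"
proof -
  define G where "G = {y \<in> A. B y j \<noteq> 0} \<union> {y \<in> A. B y k \<noteq> 0} - {j, k}"
  define F where "F = insert j (insert k G)"
  have G: "finite G" "G \<subseteq> A - {j, k}" "j \<notin> G" "k \<notin> G"
    using fin by (auto simp: G_def)
  have F: "finite F" "F \<subseteq> A"
    using G jk by (auto simp: F_def)
  have prodF: "prod h F = h j * h k * prod h G" for h :: "nat \<Rightarrow> qfield"
    using G jk(3) by (simp add: F_def mult.assoc)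
  have bc: "b > 0" "c > 0" "int b = - B j k" "int c = B k j"
    using jk by (auto simp: b_def c_def)
  define g where "g y = nat (- B1 y k)" for y
  define u where "u y = nat (B1 y k)" for y
  define m1 where "m1 y = nat (B2 y j)" for y
  \<comment> \<open>Chosen so that \<open>?m w\<close> splits off in \<open>id1\<close> and
    \<open>id2\<close> below, leaving the two monomials in \<open>G\<close> of the first exchange
    polynomial at \<open>j\<close>.\<close>
  define w where "w y = nat (max (int c * int (g y)) (- B y j) - max 0 (- B y j))" for y
  let ?m = "\<lambda>e. \<Prod>y\<in>G. Xvar y ^ e y"
  have B1: "B1 j k = int b" "B1 k k = 0" "B1 k j = - int c" "B1 j j = 0"
    using jk bc by (auto simp: B1_def matrix_mutation_eq)
  have B2j: "B2 j j = 0" "B2 k j = int c"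
    using B1 bc jk(3) by (auto simp: B2_def matrix_mutation_eq)
  have B2: "B2 y j = - B y j - int c * int (g y)" if "y \<in> G" for y
  proof -
    have "y \<noteq> j" "y \<noteq> k" using that G by auto
    then show ?thesis
      using B1 bc jk(3) by (auto simp: B2_def matrix_mutation_eq[of k] g_def) (auto simp: B1_def matrix_mutation_def)
  qed
  have "{y \<in> A. B1 y k \<noteq> 0} \<subseteq> F"
    by (auto simp: F_def G_def B1_def matrix_mutation_eq split: if_splits)
  moreover from this have "{y \<in> A. B2 y j \<noteq> 0} \<subseteq> F"
    using jk(3) by (auto simp: F_def G_def B2_def matrix_mutation_eq[of k]) (auto simp: B1_def matrix_mutation_def split: if_splits)
  moreover have "{y \<in> A. B y j \<noteq> 0} \<subseteq> F"
    by (auto simp: F_def G_def)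
  ultimately have exch_eq: "exch A B j v = (\<Prod>y\<in>F. v y ^ nat (B y j)) + (\<Prod>y\<in>F. v y ^ nat (- B y j))"
    "exch A B1 k v = (\<Prod>y\<in>F. v y ^ nat (B1 y k)) + (\<Prod>y\<in>F. v y ^ nat (- B1 y k))"
    "exch A B2 j v = (\<Prod>y\<in>F. v y ^ nat (B2 y j)) + (\<Prod>y\<in>F. v y ^ nat (- B2 y j))" for v
    by (auto intro!: exch_superset F)
  have v1: "v1 y = Xvar y" "v2 y = Xvar y" if "y \<in> G" for y
    using that G by (auto simp: v1_def v2_def)
  have v12: "v1 j = x1" "v2 j = x1" "v2 k = xk" "v1 k = Xvar k"
    using jk(3) by (auto simp: x1_def xk_def v2_def v1_def)
  have mono1: "(\<Prod>y\<in>G. v1 y ^ e y) = ?m e" "(\<Prod>y\<in>G. v2 y ^ e y) = ?m e" for e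
    using v1 by (auto intro!: prod.cong)
  have "exch A B j Xvar = Xvar k ^ c * ?m (\<lambda>y. nat (B y j)) + ?m (\<lambda>y. nat (- B y j))"
    using jk bc unfolding exch_eq(1) prodF by (simp add: c_def)
  then have x1: "x1 * Xvar j = Xvar k ^ c * ?m (\<lambda>y. nat (B y j)) + ?m (\<lambda>y. nat (- B y j))"
    by (simp add: x1_def v1_def)
  have "exch A B1 k v1 = x1 ^ b * ?m u + ?m g"
    unfolding exch_eq(2) prodF mono1 v12 B1 by (simp add: u_def g_def)
  then have xk: "xk = (x1 ^ b * ?m u + ?m g) / Xvar k"
    using jk(3) by (simp add: xk_def v2_def v12)
  have ex2: "exch A B2 j v2 = xk ^ c * ?m m1 + ?m (\<lambda>y. nat (- B2 y j))"
    unfolding exch_eq(3) prodF mono1 v12 B2j by (simp add: m1_def)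
  have pos1: "positive x1"
    unfolding x1_def v1_def by (simp add: positive_Xvar positive_exch positive_divide)
  have mm: "?m e * ?m e' = ?m (\<lambda>y. e y + e' y)" for e e'
    by (simp add: power_add prod.distrib)
  have mp: "?m e ^ n = ?m (\<lambda>y. n * e y)" for e n
    by (simp add: power_mult prod_power_distrib mult.commute[of n])
  have cong: "?m e = ?m e'" if "\<And>y. y \<in> G \<Longrightarrow> e y = e' y" for e e'
    using that by (intro prod.cong) auto
  have wg: "int (w y) = max (int c * int (g y)) (- B y j) - max 0 (- B y j)" "0 \<le> int c * int (g y)" for y
  proof -
    show "0 \<le> int c * int (g y)" by simp
    then have "0 \<le> max (int c * int (g y)) (- B y j) - max 0 (- B y j)" by linarith
    then show "int (w y) = max (int c * int (g y)) (- B y j) - max 0 (- B y j)"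
      unfolding w_def by (rule int_nat_eq[THEN trans, OF if_P])
  qed
  have id1: "?m g ^ c * ?m m1 = ?m w * ?m (\<lambda>y. nat (- B y j))"
    unfolding mm mp
  proof (rule cong)
    fix y assume "y \<in> G"
    then have "int (m1 y) = max 0 (- B y j - int c * int (g y))"
      by (simp add: m1_def B2)
    with wg[of y] have "int (c * g y + m1 y) = int (w y + nat (- B y j))"
      unfolding of_nat_add of_nat_mult by linarith
    then show "c * g y + m1 y = w y + nat (- B y j)"
      by (simp only: of_nat_eq_iff)
  qed
  have id2: "?m (\<lambda>y. nat (- B2 y j)) = ?m w * ?m (\<lambda>y. nat (B y j))"
    unfolding mm mp
  proof (rule cong)
    fix y assume "y \<in> G"
    then have "int (nat (- B2 y j)) = max 0 (B y j + int c * int (g y))"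
      by (simp add: B2)
    with wg[of y] have "int (nat (- B2 y j)) = int (w y + nat (B y j))"
      unfolding of_nat_add by linarith
    then show "nat (- B2 y j) = w y + nat (B y j)"
      by (simp only: of_nat_eq_iff)
  qed
  \<comment> \<open>The cofactor in the factorization of a difference of \<open>c\<close>-th powers
    whose bases differ by \<open>x1 ^ b * ?m u\<close>.\<close>
  define S where "S = (\<Sum>i<c. ?m g ^ (c - Suc i) * (x1 ^ b * ?m u + ?m g) ^ i)"
  have pd: "(x1 ^ b * ?m u + ?m g) ^ c - ?m g ^ c = x1 ^ b * ?m u * S"
    unfolding S_def using power_diff_sumr2[of "x1 ^ b * ?m u + ?m g" c "?m g"] by simp
  have xb: "x1 ^ b = x1 * x1 ^ (b - 1)"
    using bc(1) by (metis Suc_diff_1 power_Suc)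
  \<comment> \<open>The \<open>c\<close>-th power is reduced modulo \<open>x1 ^ b\<close>. By
    \<open>id1\<close> and \<open>id2\<close> the remainder is \<open>?m w\<close> times the first
    exchange polynomial, that is, times \<open>x1 * Xvar j\<close>. So \<open>x1\<close> factors out
    and cancels against the division by \<open>v2 j\<close>.\<close>
  have "Xvar k ^ c * exch A B2 j v2 = (x1 ^ b * ?m u + ?m g) ^ c * ?m m1 + Xvar k ^ c * (?m w * ?m (\<lambda>y. nat (B y j)))"
    unfolding ex2 id2 by (simp add: xk power_divide distrib_left)
  also have "\<dots> = (x1 ^ b * ?m u * S + ?m g ^ c) * ?m m1 + Xvar k ^ c * (?m w * ?m (\<lambda>y. nat (B y j)))"
    by (simp flip: pd)
  also have "\<dots> = x1 ^ b * ?m u * S * ?m m1 + ?m w * (Xvar k ^ c * ?m (\<lambda>y. nat (B y j)) + ?m (\<lambda>y. nat (- B y j)))"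
    using id1 by (simp add: algebra_simps)
  also have "\<dots> = x1 * (?m m1 * ?m u * x1 ^ (b - 1) * S + ?m w * Xvar j)"
    unfolding x1[symmetric] by (simp add: xb algebra_simps)
  finally have "xj = (?m m1 * ?m u * x1 ^ (b - 1) * S + ?m w * Xvar j) / Xvar k ^ c"
    using positive_nonzero[OF pos1] by (simp add: xj_def v12 field_simps)
  with xk G show thesis
    by (intro that[of G u g m1 w]) (auto simp: G_def S_def)
qed

section \<open>Rational points that witness coprimality\<close>

lemma evaluates_exch_Xvar:
  assumes "finite {y \<in> A. B y k \<noteq> 0}"
  shows "evaluates \<theta> (exch A B k Xvar) ((\<Prod>y\<in>{y \<in> A. B y k \<noteq> 0}. \<theta> y ^ nat (B y k))
    + (\<Prod>y\<in>{y \<in> A. B y k \<noteq> 0}. \<theta> y ^ nat (- B y k)))"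
proof -
  have "exch A B k Xvar = (\<Prod>y\<in>{y \<in> A. B y k \<noteq> 0}. Xvar y ^ nat (B y k))
    + (\<Prod>y\<in>{y \<in> A. B y k \<noteq> 0}. Xvar y ^ nat (- B y k))"
    using assms by (intro exch_superset) auto
  moreover have "evaluates \<theta> \<dots> ((\<Prod>y\<in>{y \<in> A. B y k \<noteq> 0}. \<theta> y ^ nat (B y k))
    + (\<Prod>y\<in>{y \<in> A. B y k \<noteq> 0}. \<theta> y ^ nat (- B y k)))"
    by (intro evaluates_add evaluates_monomial evaluates_Xvar)
  ultimately show ?thesis by simp
qed

text \<open>The \<open>i\<close>-th variable occurs with exponent one in exactly one monomial, so
  the two values are \<open>-1\<close> and \<open>1\<close>. The value at \<open>j\<close> stays
  free because \<open>B j j = 0\<close>; \<open>regular_pair_neg\<close> exploits this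
  freedom.\<close>

lemma evaluates_exch_root:
  fixes \<theta> :: "nat \<Rightarrow> rat"
  assumes fin: "finite {y \<in> A. B y j \<noteq> 0}" and "B j j = 0" "i \<in> A" "\<bar>B i j\<bar> = 1"
    and \<theta>: "\<theta> i = -1" "\<And>y. y \<noteq> i \<Longrightarrow> y \<noteq> j \<Longrightarrow> \<theta> y = 1"
  shows "evaluates \<theta> (exch A B j Xvar) 0"
proof -
  let ?F = "{y \<in> A. B y j \<noteq> 0}"
  have "(\<Prod>y\<in>?F. \<theta> y ^ e y) = (-1) ^ e i" for e
  proof -
    have "(\<Prod>y\<in>?F. \<theta> y ^ e y) = \<theta> i ^ e i * (\<Prod>y\<in>?F - {i}. \<theta> y ^ e y)"
      using assms by (intro prod.remove) auto
    moreover have "(\<Prod>y\<in>?F - {i}. \<theta> y ^ e y) = 1"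
    proof (intro prod.neutral ballI)
      fix y assume "y \<in> ?F - {i}"
      then have "y \<noteq> i" "y \<noteq> j" using assms(2) by auto
      then show "\<theta> y ^ e y = 1" using \<theta>(2) by simp
    qed
    ultimately show ?thesis using \<theta>(1) by simp
  qed
  moreover have "(-1::rat) ^ nat (B i j) + (-1) ^ nat (- B i j) = 0"
    using assms(4) by (cases "B i j \<ge> 0") auto
  ultimately show ?thesis
    using evaluates_exch_Xvar[of A B j \<theta>, OF fin] by simp
qed

lemma abs_monomial_1:
  fixes \<theta> :: "nat \<Rightarrow> rat"
  assumes "\<And>y. y \<in> G \<Longrightarrow> \<bar>\<theta> y\<bar> = 1"
  shows "\<bar>\<Prod>y\<in>G. \<theta> y ^ e y\<bar> = 1"
  using assms by (simp add: abs_prod power_abs)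

lemma laurent_ring_divide_Xvar:
  "z \<in> laurent_ring I A Xvar \<Longrightarrow> k \<in> I \<Longrightarrow> z / Xvar k ^ n \<in> laurent_ring I A Xvar"
  unfolding divide_inverse power_inverse[symmetric]
  by (intro laurent_ring.mult laurent_ring_power laurent_ring.inv)

text \<open>Certifies that \<open>p\<close> does not divide \<open>q\<close> in the Laurent ring:
  \<open>p\<close> vanishes at a point where \<open>q\<close> does not. All coordinates are nonzero,
  so that every Laurent polynomial has a value there.\<close>

definition regular_pair :: "nat set \<Rightarrow> qfield \<Rightarrow> qfield \<Rightarrow> bool" where
  "regular_pair A p q \<longleftrightarrow> q \<in> laurent_ring A A Xvar \<and>
     (\<exists>\<theta>::nat \<Rightarrow> rat. (\<forall>y. \<theta> y \<noteq> 0) \<and> evaluates \<theta> p 0 \<and> (\<exists>t. t \<noteq> 0 \<and> evaluates \<theta> q t))"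

text \<open>The two directions do not interact: the step at \<open>k\<close> is that of the initial
  seed, and the second step at \<open>j\<close> returns to \<open>Xvar j\<close>. With
  \<open>-1\<close> at \<open>i\<close> and \<open>1\<close> elsewhere the exchange polynomial at
  \<open>k\<close> has value \<open>2\<close>, since \<open>i\<close> is absent from column
  \<open>k\<close>.\<close>

lemma regular_pair_zero:
  fixes B :: "nat \<Rightarrow> nat \<Rightarrow> int" and A j k
  defines "v1 \<equiv> Xvar(j := exch A B j Xvar / Xvar j)" and "B1 \<equiv> matrix_mutation j B"
  defines "v2 \<equiv> v1(k := exch A B1 k v1 / v1 k)" and "B2 \<equiv> matrix_mutation k B1"
  assumes jk: "j \<in> A" "k \<in> A" "j \<noteq> k" "B j j = 0" "B k k = 0" "B j k = 0" "B k j = 0"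
    and fin: "finite {y \<in> A. B y j \<noteq> 0}" "finite {y \<in> A. B y k \<noteq> 0}"
    and i: "i \<in> A" "\<bar>B i j\<bar> = 1" "B i k = 0"
  shows "v2 k \<in> laurent_ring A A Xvar" "exch A B2 j v2 / v2 j \<in> laurent_ring A A Xvar"
    "regular_pair A (exch A B j Xvar) (v2 k * (exch A B2 j v2 / v2 j))"
proof -
  have ij: "i \<noteq> j" "i \<noteq> k" using jk i by auto
  have B1: "B1 y k = B y k" for y
    using jk by (auto simp: B1_def matrix_mutation_eq)
  have B2: "B2 y j = - B y j" for y
    using jk by (auto simp: B2_def B1_def matrix_mutation_def)
  have "exch A B1 k v1 = exch A B k Xvar"
    unfolding exch_def B1 using jk by (intro arg_cong2[where f = "(+)"] prod.cong) (auto simp: v1_def)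
  then have xk: "v2 k = exch A B k Xvar / Xvar k"
    using jk(3) by (simp add: v2_def v1_def)
  have "exch A B2 j v2 = exch A (\<lambda>y z. - B y z) j Xvar"
    unfolding exch_def B2 using jk
    by (intro arg_cong2[where f = "(+)"] prod.cong) (auto simp: v2_def v1_def)
  moreover have "exch A B j Xvar \<noteq> 0"
    by (intro positive_nonzero positive_exch positive_Xvar)
  ultimately have xj: "exch A B2 j v2 / v2 j = Xvar j"
    using jk(3) by (simp add: v2_def v1_def exch_uminus)
  have "exch A B k Xvar / Xvar k ^ 1 \<in> laurent_ring A A Xvar"
    by (intro laurent_ring_divide_Xvar exch_laurent_ring laurent_ring.var jk)
  then show L: "v2 k \<in> laurent_ring A A Xvar" "exch A B2 j v2 / v2 j \<in> laurent_ring A A Xvar"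
    unfolding xk xj using jk by (simp_all add: laurent_ring.var)
  define \<theta> :: "nat \<Rightarrow> rat" where "\<theta> = (\<lambda>y. if y = i then -1 else 1)"
  have "evaluates \<theta> (exch A B j Xvar) 0"
    using fin jk i by (intro evaluates_exch_root[of A B j i]) (auto simp: \<theta>_def)
  moreover have "evaluates \<theta> (exch A B k Xvar) (1 + 1)"
  proof -
    have "(\<Prod>y\<in>{y \<in> A. B y k \<noteq> 0}. \<theta> y ^ e y) = 1" for e
      using i(3) by (intro prod.neutral) (auto simp: \<theta>_def)
    then show ?thesis
      using evaluates_exch_Xvar[of A B k \<theta>, OF fin(2)] by simp
  qed
  then have "evaluates \<theta> (v2 k * (exch A B2 j v2 / v2 j)) ((1 + 1) / \<theta> k * \<theta> j)"
    unfolding xk xj by (intro evaluates_mult evaluates_divide evaluates_Xvar) (simp_all add: \<theta>_def)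
  moreover have "(1 + 1) / \<theta> k * \<theta> j \<noteq> 0" "\<forall>y. \<theta> y \<noteq> 0"
    by (simp_all add: \<theta>_def)
  ultimately show "regular_pair A (exch A B j Xvar) (v2 k * (exch A B2 j v2 / v2 j))"
    unfolding regular_pair_def using L by (metis laurent_ring.mult)
qed

text \<open>The formulas of \<open>rank_two_mutation\<close> are evaluated at a zero of the first
  exchange polynomial. There \<open>x1\<close> is \<open>0\<close>, so \<open>v2 k\<close> reduces
  to a Laurent monomial, and the last variable to a sum of two terms of different size.\<close>

lemma regular_pair_neg:
  fixes B :: "nat \<Rightarrow> nat \<Rightarrow> int" and A j k
  defines "v1 \<equiv> Xvar(j := exch A B j Xvar / Xvar j)" and "B1 \<equiv> matrix_mutation j B"
  defines "v2 \<equiv> v1(k := exch A B1 k v1 / v1 k)" and "B2 \<equiv> matrix_mutation k B1"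
  assumes jk: "j \<in> A" "k \<in> A" "j \<noteq> k" "B j j = 0" "B k k = 0" "B j k < 0" "B k j > 0"
    and fin: "finite {y \<in> A. B y j \<noteq> 0}" "finite {y \<in> A. B y k \<noteq> 0}"
    and i: "i \<in> A" "\<bar>B i j\<bar> = 1" "B i k = 0" "i \<noteq> k"
  shows "v2 k \<in> laurent_ring A A Xvar" "exch A B2 j v2 / v2 j \<in> laurent_ring A A Xvar"
    "regular_pair A (exch A B j Xvar) (v2 k * (exch A B2 j v2 / v2 j))"
proof -
  define b c where "b = nat (- B j k)" and "c = nat (B k j)"
  define x1 where "x1 = v1 j"
  obtain G m1 u w and g :: "nat \<Rightarrow> nat" where G: "finite G" "G \<subseteq> A - {j, k}"
    "v2 k = (x1 ^ b * (\<Prod>y\<in>G. Xvar y ^ u y) + (\<Prod>y\<in>G. Xvar y ^ g y)) / Xvar k"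
    "exch A B2 j v2 / v2 j = ((\<Prod>y\<in>G. Xvar y ^ m1 y) * (\<Prod>y\<in>G. Xvar y ^ u y) * x1 ^ (b - 1)
        * (\<Sum>i<c. (\<Prod>y\<in>G. Xvar y ^ g y) ^ (c - Suc i) * (x1 ^ b * (\<Prod>y\<in>G. Xvar y ^ u y) + (\<Prod>y\<in>G. Xvar y ^ g y)) ^ i)
        + (\<Prod>y\<in>G. Xvar y ^ w y) * Xvar j) / Xvar k ^ c"
    by (rule rank_two_mutation[OF jk fin, folded v1_def B1_def, folded v2_def B2_def b_def c_def x1_def])
  have bc: "b > 0" "c > 0" and ik: "i \<noteq> k" "i \<noteq> j" using jk i by (auto simp: b_def c_def)
  have mL: "(\<Prod>y\<in>G. Xvar y ^ e y) \<in> laurent_ring A A Xvar" for e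
    using G(2) by (intro laurent_ring_monomial) auto
  have "exch A B j Xvar / Xvar j ^ 1 \<in> laurent_ring A A Xvar"
    by (intro laurent_ring_divide_Xvar exch_laurent_ring laurent_ring.var jk)
  then have x1L: "x1 \<in> laurent_ring A A Xvar"
    by (simp add: x1_def v1_def)
  have "(x1 ^ b * (\<Prod>y\<in>G. Xvar y ^ u y) + (\<Prod>y\<in>G. Xvar y ^ g y)) / Xvar k ^ 1 \<in> laurent_ring A A Xvar"
    by (intro laurent_ring_divide_Xvar laurent_ring.add laurent_ring.mult laurent_ring_power x1L mL jk)
  then have xkL: "v2 k \<in> laurent_ring A A Xvar"
    unfolding G(3) by simp
  have xjL: "exch A B2 j v2 / v2 j \<in> laurent_ring A A Xvar"
    unfolding G(4) by (intro laurent_ring_divide_Xvar laurent_ring.add laurent_ring.mult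
        laurent_ring_power laurent_ring_sum x1L mL jk laurent_ring.var)
  show "v2 k \<in> laurent_ring A A Xvar" "exch A B2 j v2 / v2 j \<in> laurent_ring A A Xvar"
    by (fact xkL xjL)+
  \<comment> \<open>At this point monomials free of the \<^term>\<open>j\<close>-th variable are \<open>\<plusminus>1\<close>, and the summand of
    absolute value \<open>2 c\<close> cannot be cancelled by the other one, which is at most \<open>c\<close>.\<close>
  define \<theta> :: "nat \<Rightarrow> rat" where "\<theta> = (\<lambda>y. if y = i then -1 else if y = j then 2 * of_nat c else 1)"
  define m where "m e = (\<Prod>y\<in>G. \<theta> y ^ e y)" for e
  have m: "evaluates \<theta> (\<Prod>y\<in>G. Xvar y ^ e y) (m e)" for e
    unfolding m_def by (intro evaluates_monomial evaluates_Xvar)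
  have "\<bar>\<theta> y\<bar> = 1" if "y \<in> G" for y
    using that G(2) by (auto simp: \<theta>_def)
  then have am: "\<bar>m e\<bar> = 1" for e
    unfolding m_def by (rule abs_monomial_1)
  have nz: "\<forall>y. \<theta> y \<noteq> 0" and \<theta>k: "\<theta> k = 1" "\<theta> j = 2 * of_nat c"
    using bc ik jk(3) by (auto simp: \<theta>_def)
  have p: "evaluates \<theta> (exch A B j Xvar) 0"
    using fin jk i ik by (intro evaluates_exch_root[of A B j i]) (auto simp: \<theta>_def)
  then have "evaluates \<theta> x1 (0 / \<theta> j)"
    unfolding x1_def v1_def fun_upd_same using nz by (intro evaluates_divide evaluates_Xvar) auto
  then have x1: "evaluates \<theta> x1 0" by simp
  define t where "t = (0 ^ b * m u + m g) / \<theta> k"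
  define s where "s = (m m1 * m u * 0 ^ (b - 1) * (\<Sum>i<c. m g ^ (c - Suc i) * (0 ^ b * m u + m g) ^ i)
      + m w * \<theta> j) / \<theta> k ^ c"
  have "evaluates \<theta> (v2 k) t"
    unfolding G(3) t_def using nz
    by (intro evaluates_divide evaluates_add evaluates_mult evaluates_power m x1 evaluates_Xvar) auto
  moreover have "evaluates \<theta> (exch A B2 j v2 / v2 j) s"
    unfolding G(4) s_def using nz
    by (intro evaluates_divide evaluates_add evaluates_mult evaluates_power evaluates_sum m x1 evaluates_Xvar) auto
  ultimately have "evaluates \<theta> (v2 k * (exch A B2 j v2 / v2 j)) (t * s)"
    by (rule evaluates_mult)
  moreover have "t \<noteq> 0"
    using am[of g] by (auto simp: t_def \<theta>k zero_power[OF bc(1)])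
  moreover have "s \<noteq> 0"
  proof -
    \<comment> \<open>The power \<open>0 ^ (b - 1)\<close> equals \<open>1\<close> for
      \<open>b = 1\<close> and \<open>0\<close> for larger \<open>b\<close>, so one bound on
      \<open>r\<close> serves both cases.\<close>
    define r where "r = m m1 * m u * 0 ^ (b - 1) * (\<Sum>i<c. m g ^ (c - Suc i) * (0 ^ b * m u + m g) ^ i)"
    have "\<bar>\<Sum>i<c. m g ^ (c - Suc i) * (0 ^ b * m u + m g) ^ i\<bar>
        \<le> (\<Sum>i<c. \<bar>m g ^ (c - Suc i) * (0 ^ b * m u + m g) ^ i\<bar>)"
      by (rule sum_abs)
    also have "\<dots> = of_nat c"
      by (simp add: abs_mult power_abs am zero_power[OF bc(1)])
    finally have "\<bar>r\<bar> \<le> of_nat c"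
      by (cases "b - 1 = 0") (simp_all add: r_def abs_mult am zero_power)
    moreover have "\<bar>m w * \<theta> j\<bar> = 2 * of_nat c"
      by (simp add: abs_mult am \<theta>k)
    moreover have "of_nat c > (0::rat)"
      using bc(2) by simp
    ultimately have "r + m w * \<theta> j \<noteq> 0"
      by linarith
    then show ?thesis
      by (simp add: s_def r_def \<theta>k(1))
  qed
  ultimately show "regular_pair A (exch A B j Xvar) (v2 k * (exch A B2 j v2 / v2 j))"
    unfolding regular_pair_def using nz p xkL xjL laurent_ring.mult
    by (metis mult_eq_0_iff)
qed

text \<open>Sign-skewness leaves three cases; the one with \<open>B j k > 0\<close> follows from
  \<open>regular_pair_neg\<close> for the negated matrix.\<close>

lemma regular_pair_neighbours:
  fixes B :: "nat \<Rightarrow> nat \<Rightarrow> int" and A j k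
  defines "v1 \<equiv> Xvar(j := exch A B j Xvar / Xvar j)" and "B1 \<equiv> matrix_mutation j B"
  defines "v2 \<equiv> v1(k := exch A B1 k v1 / v1 k)" and "B2 \<equiv> matrix_mutation k B1"
  assumes jk: "j \<in> A" "k \<in> A" "j \<noteq> k" "B j j = 0" "B k k = 0" "sgn (B j k) = - sgn (B k j)"
    and fin: "finite {y \<in> A. B y j \<noteq> 0}" "finite {y \<in> A. B y k \<noteq> 0}"
    and i: "i \<in> A" "\<bar>B i j\<bar> = 1" "B i k = 0" "i \<noteq> k"
  shows "v2 k \<in> laurent_ring A A Xvar \<and> exch A B2 j v2 / v2 j \<in> laurent_ring A A Xvar \<and>
    regular_pair A (exch A B j Xvar) (v2 k * (exch A B2 j v2 / v2 j))"
proof -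
  consider "B j k = 0" "B k j = 0" | "B j k < 0" "B k j > 0" | "B j k > 0" "B k j < 0"
    using jk(6) by (auto simp: sgn_if split: if_splits)
  then show ?thesis
  proof cases
    case 1
    show ?thesis
      using regular_pair_zero[OF jk(1-5) 1 fin i(1-3), folded v1_def B1_def, folded v2_def B2_def]
      by blast
  next
    case 2
    show ?thesis
      using regular_pair_neg[OF jk(1-5) 2 fin i, folded v1_def B1_def, folded v2_def B2_def]
      by blast
  next
    case 3
    note neg = regular_pair_neg[where B = "\<lambda>y z. - B y z" and A = A and j = j and k = k and i = i,
        unfolded matrix_mutation_uminus exch_uminus, folded v1_def B1_def, folded v2_def B2_def]
    show ?thesis
      by (intro conjI; rule neg) (use jk fin i 3 in simp_all)
  qed
qed

text \<open>The core of the Laurent phenomenon. Read in \<open>v1\<close>, the element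
  \<open>z\<close> has a power of \<open>p\<close> as denominator; read in \<open>v3\<close>, a
  power of \<open>q\<close>. As \<open>p\<close> is prime and does not divide \<open>q\<close>, the
  powers of \<open>p\<close> cancel. This runs in \<open>L\<close>, where all variables are
  inverted; the inverses of frozen variables are removed at the end.\<close>

lemma laurent_ring_two_neighbours:
  fixes B :: "nat \<Rightarrow> nat \<Rightarrow> int" and A j k
  defines "v1 \<equiv> Xvar(j := exch A B j Xvar / Xvar j)" and "B1 \<equiv> matrix_mutation j B"
  defines "v2 \<equiv> v1(k := exch A B1 k v1 / v1 k)" and "B2 \<equiv> matrix_mutation k B1"
  defines "v3 \<equiv> v2(j := exch A B2 j v2 / v2 j)"
  assumes valid: "valid_matrix I A B" "I \<subseteq> A" "j \<in> I" "k \<in> I" "j \<noteq> k"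
    and i: "i \<in> A" "\<bar>B i j\<bar> = 1" "B i k = 0" "i \<noteq> k"
    and z: "z \<in> laurent_ring I A v1" "z \<in> laurent_ring I A v3"
  shows "z \<in> laurent_ring I A Xvar"
proof -
  define L where "L = laurent_ring A A Xvar"
  define p where "p = exch A B j Xvar"
  \<comment> \<open>\<open>v3\<close> differs from the initial cluster only at \<open>j\<close> and
    \<open>k\<close>, so \<open>q\<close> collects its new variables.\<close>
  define q where "q = v2 k * v3 j"
  have A: "j \<in> A" "k \<in> A" using valid by auto
  have diag: "B j j = 0" "B k k = 0" and fin: "finite {y \<in> A. B y j \<noteq> 0}" "finite {y \<in> A. B y k \<noteq> 0}"
    using valid valid_matrix_diag unfolding valid_matrix_def by blast+
  have v3j: "v3 j = exch A B2 j v2 / v2 j"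
    by (simp add: v3_def)
  have "v2 k \<in> L \<and> v3 j \<in> L \<and> regular_pair A p q"
    unfolding L_def q_def v3j p_def
    by (rule regular_pair_neighbours[OF A valid(5) diag valid_matrix_sgn[OF valid(1,3,4)] fin i,
          folded v1_def B1_def, folded v2_def B2_def])
  then have L: "v2 k \<in> L" "v3 j \<in> L" "q \<in> L"
    and "\<exists>\<theta>::nat \<Rightarrow> rat. (\<forall>y. \<theta> y \<noteq> 0) \<and> evaluates \<theta> p 0 \<and> (\<exists>t. t \<noteq> 0 \<and> evaluates \<theta> q t)"
    unfolding regular_pair_def L_def by blast+
  then obtain \<theta> :: "nat \<Rightarrow> rat" and t
    where \<theta>: "\<And>y. \<theta> y \<noteq> 0" "evaluates \<theta> p 0" "t \<noteq> 0" "evaluates \<theta> q t"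
    by blast
  have pos1: "positive (v1 y)" for y
    unfolding v1_def by (auto intro!: positive_divide positive_exch positive_Xvar)
  have pos2: "positive (v2 y)" for y
    unfolding v2_def by (auto intro!: positive_divide positive_exch pos1)
  have pos3: "positive (v3 y)" for y
    unfolding v3_def by (auto intro!: positive_divide positive_exch pos2)
  have p0: "p \<noteq> 0"
    unfolding p_def by (intro positive_nonzero positive_exch positive_Xvar)
  have pR: "p \<in> laurent_ring I A Xvar"
    unfolding p_def by (intro exch_laurent_ring laurent_ring.var)
  have v1: "v1 y = (if y = j then p / Xvar j else Xvar y)" for y
    by (simp add: v1_def p_def)
  have "\<exists>n. z * p ^ n \<in> laurent_ring I A Xvar"
  proof (rule laurent_ring_clear_denominators[OF z(1) pR])
    show "v1 y \<in> laurent_ring I A Xvar" if "y \<in> A" for y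
      using that laurent_ring_divide_Xvar[OF pR valid(3), of 1] by (auto simp: v1 laurent_ring.var)
    show "\<exists>n. inverse (v1 y) * p ^ n \<in> laurent_ring I A Xvar" if "y \<in> I" for y
    proof (cases "y = j")
      case True
      then have "inverse (v1 y) * p ^ 1 = Xvar j"
        using p0 by (simp add: v1)
      then show ?thesis
        using A(1) laurent_ring.var by metis
    next
      case False
      then have "inverse (v1 y) * p ^ 0 = inverse (Xvar y)"
        by (simp add: v1)
      then show ?thesis
        using that laurent_ring.inv by metis
    qed
  qed
  then obtain n where n: "z * p ^ n \<in> laurent_ring I A Xvar" by blast
  have v3: "v3 y = (if y = j then v3 j else if y = k then v2 k else Xvar y)" for y
    by (auto simp: v3_def v2_def v1_def)
  have "\<exists>n. z * q ^ n \<in> L"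
    unfolding L_def
  proof (rule laurent_ring_clear_denominators[OF z(2) L(3)[unfolded L_def]])
    show "v3 y \<in> laurent_ring A A Xvar" if "y \<in> A" for y
      using that L by (subst v3) (auto simp: L_def laurent_ring.var)
    show "\<exists>n. inverse (v3 y) * q ^ n \<in> laurent_ring A A Xvar" if "y \<in> I" for y
    proof -
      consider "y = j" | "y = k" | "y \<noteq> j" "y \<noteq> k" by blast
      then show ?thesis
      proof cases
        case 1
        then have "inverse (v3 y) * q ^ 1 = v2 k"
          using positive_nonzero[OF pos3] by (simp add: q_def)
        then show ?thesis using L(1) L_def by metis
      next
        case 2
        then have "inverse (v3 y) * q ^ 1 = v3 j"
          using positive_nonzero[OF pos2] valid(5) by (subst v3) (simp add: q_def)
        then show ?thesis using L(2) L_def by metis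
      next
        case 3
        then have "inverse (v3 y) * q ^ 0 = inverse (Xvar y)"
          by (subst v3) simp
        then show ?thesis
          using that valid(2) laurent_ring.inv by (metis subsetD)
      qed
    qed
  qed
  then obtain m where m: "z * q ^ m \<in> L" by blast
  have prime: "\<exists>c\<in>L. h = p * c" if "h \<in> L" "c \<in> L" "q ^ m * h = p * c" for h c
  proof -
    define F where "F = {y \<in> A. B y j \<noteq> 0} - {i}"
    have i_in: "i \<in> {y \<in> A. B y j \<noteq> 0}" using i by auto
    have pr: "prod h {y \<in> A. B y j \<noteq> 0} = h i * prod h F" for h :: "nat \<Rightarrow> qfield"
      unfolding F_def by (rule prod.remove[OF fin(1) i_in])
    have pe: "p = Xvar i ^ nat (B i j) * (\<Prod>y\<in>F. Xvar y ^ nat (B y j))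
        + Xvar i ^ nat (- B i j) * (\<Prod>y\<in>F. Xvar y ^ nat (- B y j))"
      unfolding p_def using exch_superset[of "{y \<in> A. B y j \<noteq> 0}" A B j Xvar, unfolded pr] fin(1) by auto
    have F: "F \<subseteq> A" "i \<in> A" "i \<notin> F" using i by (auto simp: F_def)
    have qm: "evaluates \<theta> (q ^ m) (t ^ m)" "t ^ m \<noteq> 0" "q ^ m \<in> L"
      using \<theta>(3,4) L(3) by (auto simp: L_def intro: evaluates_power laurent_ring_power)
    consider "B i j = 1" | "B i j = -1" using i(2) by linarith
    then show ?thesis
    proof cases
      case 1
      then have "p = Xvar i * (\<Prod>y\<in>F. Xvar y ^ nat (B y j)) + (\<Prod>y\<in>F. Xvar y ^ nat (- B y j))"
        by (simp add: pe)
      then show ?thesis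
        using that qm unfolding L_def
        by (intro prime_linear_polynomial[OF refl refl F _ \<theta>(1,2)])
    next
      case 2
      then have "p = Xvar i * (\<Prod>y\<in>F. Xvar y ^ nat (- B y j)) + (\<Prod>y\<in>F. Xvar y ^ nat (B y j))"
        by (simp add: pe)
      then show ?thesis
        using that qm unfolding L_def
        by (intro prime_linear_polynomial[OF refl refl F _ \<theta>(1,2)])
    qed
  qed
  have pL: "p \<in> L"
    unfolding L_def by (rule laurent_ring_mono[OF valid(2) subset_refl pR])
  have "z * p ^ n \<in> L"
    unfolding L_def by (rule laurent_ring_mono[OF valid(2) subset_refl n])
  \<comment> \<open>One factor \<open>p\<close> is cancelled at a time: \<open>p\<close> divides
    \<open>q ^ m * (z * p ^ Suc n)\<close>, hence by \<open>prime\<close> it divides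
    \<open>z * p ^ Suc n\<close> in \<open>L\<close>.\<close>
  then have zL: "z \<in> L"
  proof (induction n)
    case (Suc n)
    have "p ^ n * (z * q ^ m) \<in> L"
      using laurent_ring.mult[OF laurent_ring_power] pL m unfolding L_def by blast
    moreover have "q ^ m * (z * p ^ Suc n) = p * (p ^ n * (z * q ^ m))"
      by (simp add: algebra_simps)
    ultimately obtain c where c: "c \<in> L" "z * p ^ Suc n = p * c"
      using prime[OF Suc.prems] by blast
    then have "z * p ^ n = c"
      using p0 by (simp add: algebra_simps)
    with c Suc.IH show ?case by simp
  qed simp
  show ?thesis
  proof (rule laurent_ring_frozen_polynomial[OF zL[unfolded L_def] n pR])
    fix y assume "y \<in> A - I"
    have "evaluates (Xvar(y := 0)) p (exch A B j (Xvar(y := 0)))"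
      unfolding p_def by (intro evaluates_exch evaluates_Xvar)
    then show "\<exists>w. evaluates (Xvar(y := 0)) p w \<and> w \<noteq> 0"
      using exch_zero_subst(1)[of A B j y, OF fin(1)] positive_nonzero by blast
  qed
qed

section \<open>The Laurent phenomenon\<close>

lemma prod_insert_1: "h a = 1 \<Longrightarrow> prod h (insert a F) = prod h F"
  by (cases "finite F") (simp_all add: prod.insert_if)

lemma exch_add_frozen:
  assumes "\<And>a b. B' (Suc a) (Suc b) = B a b"
  shows "exch (insert 0 (Suc ` A)) B' (Suc k) (case_nat 1 v) = exch A B k v"
proof -
  have prod_eq: "(\<Prod>y\<in>{y \<in> insert 0 (Suc ` A). P y}. case_nat 1 v y ^ e y) = (\<Prod>y\<in>{y \<in> A. P (Suc y)}. v y ^ e (Suc y))"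
    for P and e :: "nat \<Rightarrow> nat"
  proof -
    have "(\<Prod>y\<in>{y \<in> insert 0 (Suc ` A). P y}. case_nat 1 v y ^ e y)
        = (\<Prod>y\<in>Suc ` {y \<in> A. P (Suc y)}. case_nat 1 v y ^ e y)"
    proof (cases "P 0")
      case True
      then have *: "{y \<in> insert 0 (Suc ` A). P y} = insert 0 (Suc ` {y \<in> A. P (Suc y)})" by auto
      show ?thesis unfolding * by (rule prod_insert_1) simp
    next
      case False
      then have *: "{y \<in> insert 0 (Suc ` A). P y} = Suc ` {y \<in> A. P (Suc y)}" by auto
      show ?thesis unfolding * ..
    qed
    then show ?thesis by (simp add: prod.reindex)
  qed
  show ?thesis
    unfolding exch_def prod_eq assms ..
qed

text \<open>The extra variable at \<open>0\<close> is set to \<open>1\<close> and never mutated, so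
  it disappears from all exchange polynomials. Its row may change along the path, hence only shifted
  entries of the matrices are compared.\<close>

lemma run_add_frozen:
  assumes "allv T = insert 0 (Suc ` allv S)" "\<And>a b. B' (Suc a) (Suc b) = B a b"
  shows "fst (run T (case_nat 1 v, B') (map Suc ks)) = case_nat 1 (fst (run S (v, B) ks))"
  using assms(2)
proof (induction ks arbitrary: v B B')
  case (Cons k ks)
  have "(case_nat 1 v)(Suc k := c) = case_nat 1 (v(k := c))" for c :: qfield
    by (auto simp: fun_eq_iff split: nat.split)
  then have "mutate T (Suc k) (case_nat 1 v, B')
      = (case_nat 1 (v(k := exch (allv S) B k v / v k)), matrix_mutation (Suc k) B')"
    using exch_add_frozen[of B' B, OF Cons.prems] by (simp add: mutate_eq assms(1))
  moreover have "matrix_mutation (Suc k) B' (Suc a) (Suc b) = matrix_mutation k B a b" for a b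
    using Cons.prems by (simp add: matrix_mutation_def)
  ultimately show ?case
    unfolding list.map run_Cons mutate_eq[of S] using Cons.IH by metis
qed simp

text \<open>The old indices are shifted by one to free the index 0, since a seed may use all of them.\<close>

definition add_frozen :: "nat \<Rightarrow> seed \<Rightarrow> seed" where
  "add_frozen j S = \<lparr>exv = Suc ` exv S, frv = insert 0 (Suc ` frv S),
     bmat = (\<lambda>y z. case y of 0 \<Rightarrow> (if z = Suc j then 1 else 0)
        | Suc y' \<Rightarrow> (case z of 0 \<Rightarrow> 0 | Suc z' \<Rightarrow> bmat S y' z'))\<rparr>"

lemma allv_add_frozen: "allv (add_frozen j S) = insert 0 (Suc ` allv S)"
  by (auto simp: add_frozen_def allv_def)

lemma exv_add_frozen: "exv (add_frozen j S) = Suc ` exv S"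
  and bmat_add_frozen_0: "bmat (add_frozen j S) 0 z = (if z = Suc j then 1 else 0)"
  and bmat_add_frozen_Suc: "bmat (add_frozen j S) (Suc a) (Suc b) = bmat S a b"
  by (simp_all add: add_frozen_def)

lemmas add_frozen_simps = allv_add_frozen exv_add_frozen bmat_add_frozen_0 bmat_add_frozen_Suc

lemma valid_seed_add_frozen:
  assumes "valid_seed S"
  shows "valid_seed (add_frozen j S)"
  unfolding valid_seed_eq valid_matrix_def
proof (intro conjI ballI)
  have disj: "exv S \<inter> frv S = {}" and V: "valid_matrix (exv S) (allv S) (bmat S)"
    using assms by (simp_all add: valid_seed_eq)
  show "exv (add_frozen j S) \<inter> frv (add_frozen j S) = {}"
    using disj by (auto simp: add_frozen_def)
  fix z assume "z \<in> exv (add_frozen j S)"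
  then obtain z' where z': "z = Suc z'" "z' \<in> exv S"
    by (auto simp: add_frozen_def)
  have "{y \<in> allv (add_frozen j S). bmat (add_frozen j S) y z \<noteq> 0}
      \<subseteq> insert 0 (Suc ` {y \<in> allv S. bmat S y z' \<noteq> 0})"
    by (auto simp: z' add_frozen_simps)
  moreover have "finite {y \<in> allv S. bmat S y z' \<noteq> 0}"
    using V z'(2) by (simp add: valid_matrix_def)
  ultimately show "finite {y \<in> allv (add_frozen j S). bmat (add_frozen j S) y z \<noteq> 0}"
    using finite_subset by blast
next
  have V: "valid_matrix (exv S) (allv S) (bmat S)"
    using assms by (simp_all add: valid_seed_eq)
  fix y assume y: "y \<in> allv (add_frozen j S)"
  show "finite {z \<in> exv (add_frozen j S). bmat (add_frozen j S) y z \<noteq> 0}"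
  proof (cases y)
    case 0
    then have "{z \<in> exv (add_frozen j S). bmat (add_frozen j S) y z \<noteq> 0} \<subseteq> {Suc j}"
      using 0 by (auto simp: add_frozen_simps)
    then show ?thesis using finite_subset by blast
  next
    case (Suc y')
    then have "{z \<in> exv (add_frozen j S). bmat (add_frozen j S) y z \<noteq> 0} = Suc ` {z \<in> exv S. bmat S y' z \<noteq> 0}"
      using Suc by (auto simp: add_frozen_simps)
    moreover have "finite {z \<in> exv S. bmat S y' z \<noteq> 0}"
      using V y Suc by (auto simp: valid_matrix_def allv_add_frozen)
    ultimately show ?thesis by simp
  qed
next
  obtain d :: "nat \<Rightarrow> int" where d: "\<forall>k\<in>exv S. d k > 0"
    "\<forall>i\<in>exv S. \<forall>j\<in>exv S. d i * bmat S i j = - (d j * bmat S j i)"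
    using assms unfolding valid_seed_def by blast
  show "\<exists>d :: nat \<Rightarrow> int. (\<forall>k\<in>exv (add_frozen j S). d k > 0) \<and>
     (\<forall>i\<in>exv (add_frozen j S). \<forall>k\<in>exv (add_frozen j S).
       d i * bmat (add_frozen j S) i k = - (d k * bmat (add_frozen j S) k i))"
  proof (intro exI[of _ "\<lambda>n. d (n - 1)"] conjI ballI)
    show "d (k - 1) > 0" if "k \<in> exv (add_frozen j S)" for k
      using that d(1) by (auto simp: exv_add_frozen)
    fix i k assume "i \<in> exv (add_frozen j S)" "k \<in> exv (add_frozen j S)"
    then obtain i' k' where "i = Suc i'" "k = Suc k'" "i' \<in> exv S" "k' \<in> exv S"
      by (auto simp: exv_add_frozen)
    then show "d (i - 1) * bmat (add_frozen j S) i k = - (d (k - 1) * bmat (add_frozen j S) k i)"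
      using d(2)[rule_format, of i' k'] by (simp add: bmat_add_frozen_Suc)
  qed
qed

text \<open>Mutation formulas are universal: the expansion over the initial cluster with matrix
  \<open>B\<close> becomes, after substituting \<open>v\<close>, the expansion over the state
  \<open>(v, B)\<close>.\<close>

lemma laurent_transport:
  assumes "cvar (S\<lparr>bmat := B\<rparr>) ks y \<in> laurent (S\<lparr>bmat := B\<rparr>)" "\<And>y. positive (v y)"
  shows "fst (run S (v, B) ks) y \<in> laurent_ring (exv S) (allv S) v"
proof -
  have allv: "allv (S\<lparr>bmat := B\<rparr>) = allv S"
    by (simp add: allv_def)
  have "cvar (S\<lparr>bmat := B\<rparr>) ks y \<in> laurent_ring (exv S) (allv S) Xvar"
    using assms(1) by (simp add: laurent_eq_laurent_ring allv)
  then obtain w where w: "w \<in> laurent_ring (exv S) (allv S) v" "evaluates v (cvar (S\<lparr>bmat := B\<rparr>) ks y) w"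
    using laurent_ring_subst positive_nonzero[OF assms(2)] by blast
  have "evaluates v (cvar (S\<lparr>bmat := B\<rparr>) ks y) (fst (run S (v, B) ks) y)"
    using evaluates_cvar[where v = v and S = "S\<lparr>bmat := B\<rparr>" and ks = ks and y = y, OF assms(2)] run_cong_allv[OF allv] by simp
  with w show ?thesis
    using evaluates_unique by metis
qed

text \<open>The endpoint is reread from two other clusters along strictly shorter paths:
  \<open>k # ks\<close> from \<open>v1\<close>, and \<open>j # ks\<close> from \<open>v3\<close>,
  whose first step goes back to \<open>v2\<close>. These states carry other matrices, so
  \<open>IH\<close> ranges over all valid \<open>B\<close>.\<close>

lemma laurent_step:
  assumes valid: "valid_seed S" and jk: "j \<in> exv S" "k \<in> exv S" "j \<noteq> k"
    and i: "i \<in> allv S" "\<bar>bmat S i j\<bar> = 1" "bmat S i k = 0" "i \<noteq> k"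
    and IH: "\<And>B ks'. valid_seed (S\<lparr>bmat := B\<rparr>) \<Longrightarrow> length ks' < length (j # k # ks) \<Longrightarrow>
      ks' \<in> lists (exv S) \<Longrightarrow> cvar (S\<lparr>bmat := B\<rparr>) ks' y \<in> laurent (S\<lparr>bmat := B\<rparr>)"
    and ks: "ks \<in> lists (exv S)"
  shows "cvar S (j # k # ks) y \<in> laurent S"
proof -
  define A where "A = allv S"
  define B where "B = bmat S"
  define v1 where "v1 = Xvar(j := exch A B j Xvar / Xvar j)"
  define B1 where "B1 = matrix_mutation j B"
  define v2 where "v2 = v1(k := exch A B1 k v1 / v1 k)"
  define B2 where "B2 = matrix_mutation k B1"
  define v3 where "v3 = v2(j := exch A B2 j v2 / v2 j)"
  define B3 where "B3 = matrix_mutation j B2"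
  have valid0: "valid_matrix (exv S) A B" and disj: "exv S \<inter> frv S = {}" and sub: "exv S \<subseteq> A"
    using valid by (auto simp: valid_seed_eq A_def B_def allv_def)
  have valid1: "valid_matrix (exv S) A B1"
    unfolding B1_def by (intro valid_matrix_mutation valid0 jk sub)
  have valid2: "valid_matrix (exv S) A B2"
    unfolding B2_def by (intro valid_matrix_mutation valid1 jk sub)
  have valid3: "valid_matrix (exv S) A B3"
    unfolding B3_def by (intro valid_matrix_mutation valid2 jk sub)
  have pos1: "positive (v1 y)" for y
    unfolding v1_def by (auto intro!: positive_divide positive_exch positive_Xvar)
  have pos2: "positive (v2 y)" for y
    unfolding v2_def by (auto intro!: positive_divide positive_exch pos1)
  have pos3: "positive (v3 y)" for y
    unfolding v3_def by (auto intro!: positive_divide positive_exch pos2)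
  have valid_seed': "valid_seed (S\<lparr>bmat := B'\<rparr>)" if "valid_matrix (exv S) A B'" for B'
    using that disj by (simp add: valid_seed_eq A_def allv_def)
  have m: "mutate S j (Xvar, B) = (v1, B1)" "mutate S k (v1, B1) = (v2, B2)" "mutate S j (v2, B2) = (v3, B3)"
    by (simp_all add: mutate_eq v1_def v2_def v3_def B1_def B2_def B3_def A_def)
  have undo: "mutate S j (v3, B3) = (v2, B2)"
    unfolding m(3)[symmetric] by (intro mutate_involutive valid_matrix_diag[OF valid2 jk(1)] pos2)
  define z where "z = cvar S (j # k # ks) y"
  have "z = fst (run S (v1, B1) (k # ks)) y"
    unfolding z_def cvar_eq by (simp add: m flip: B_def)
  also have "\<dots> \<in> laurent_ring (exv S) A v1"
    unfolding A_def using jk ks by (intro laurent_transport IH valid_seed' valid1 pos1) auto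
  finally have z1: "z \<in> laurent_ring (exv S) A v1" .
  have "z = fst (run S (v3, B3) (j # ks)) y"
    unfolding z_def cvar_eq by (simp add: m undo flip: B_def)
  also have "\<dots> \<in> laurent_ring (exv S) A v3"
    unfolding A_def using jk ks by (intro laurent_transport IH valid_seed' valid3 pos3) auto
  finally have z3: "z \<in> laurent_ring (exv S) A v3" .
  have "z \<in> laurent_ring (exv S) A Xvar"
  proof (rule laurent_ring_two_neighbours[OF valid0 sub jk, folded v1_def B1_def, folded v2_def B2_def, folded v3_def])
    show "i \<in> A" "\<bar>B i j\<bar> = 1" "B i k = 0" "i \<noteq> k"
      using i by (simp_all add: A_def B_def)
  qed (fact z1 z3)+
  then show ?thesis
    by (simp add: z_def laurent_eq_laurent_ring A_def)
qed

text \<open>Strong induction on the path length for all seeds at once, since rereading a path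
  changes the matrix and \<open>add_frozen\<close> changes the seed. A repetition
  \<open>j, j\<close> cancels; two different initial directions are handled by
  \<open>laurent_step\<close>.\<close>

theorem laurent_phenomenon:
  assumes "valid_seed S" "ks \<in> lists (exv S)" "y \<in> allv S"
  shows "cvar S ks y \<in> laurent S"
  using assms
proof (induction "length ks" arbitrary: S ks y rule: less_induct)
  case (less ks S y)
  have sub: "exv S \<subseteq> allv S" by (auto simp: allv_def)
  have X: "Xvar y \<in> laurent S" if "y \<in> allv S" for y
    using that by (rule laurent.var)
  consider "ks = []" | j where "ks = [j]" | j ks' where "ks = j # j # ks'"
    | j k ks' where "ks = j # k # ks'" "j \<noteq> k"
    by (metis neq_Nil_conv)
  then show ?case
  proof cases
    case 1
    then show ?thesis using less.prems X by (simp add: cvar_eq)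
  next
    case (2 j)
    have "exch (allv S) (bmat S) j Xvar / Xvar j ^ 1 \<in> laurent S"
      unfolding laurent_eq_laurent_ring using less.prems 2
      by (intro laurent_ring_divide_Xvar exch_laurent_ring laurent_ring.var) auto
    then show ?thesis
      using less.prems X 2 by (simp add: cvar_eq mutate_eq)
  next
    case (3 j ks')
    have "bmat S j j = 0"
      using less.prems 3 by (intro valid_matrix_diag[of "exv S" "allv S"]) (auto simp: valid_seed_eq)
    then have "cvar S ks y = cvar S ks' y"
      using 3 mutate_involutive[of "bmat S" j Xvar S] by (simp add: cvar_eq positive_Xvar)
    also have "\<dots> \<in> laurent S"
      using less.prems 3 by (intro less.hyps) auto
    finally show ?thesis .
  next
    case (4 j k ks')
    \<comment> \<open>The extra frozen variable serves as the index \<open>i\<close> of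
      \<open>laurent_step\<close>. Path lengths do not change, so the induction hypothesis applies
      to \<open>?T\<close> with any valid matrix.\<close>
    let ?T = "add_frozen j S"
    define \<phi> where "\<phi> = case_nat 1 Xvar"
    have "cvar ?T (Suc j # Suc k # map Suc ks') (Suc y) \<in> laurent ?T"
    proof (rule laurent_step[where i = 0])
      show "valid_seed ?T"
        using less.prems by (intro valid_seed_add_frozen)
      show "cvar (?T\<lparr>bmat := B\<rparr>) l (Suc y) \<in> laurent (?T\<lparr>bmat := B\<rparr>)"
        if "valid_seed (?T\<lparr>bmat := B\<rparr>)" "length l < length (Suc j # Suc k # map Suc ks')" "l \<in> lists (exv ?T)"
        for B l
        using that less.prems 4 by (intro less.hyps) (auto simp: allv_def exv_add_frozen add_frozen_def)
    qed (use less.prems 4 in \<open>auto simp: add_frozen_simps\<close>)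
    then have "cvar ?T (map Suc ks) (Suc y) \<in> laurent_ring (exv ?T) (allv ?T) Xvar"
      by (simp add: 4 laurent_eq_laurent_ring)
    moreover have "\<phi> l \<noteq> 0" for l
      by (simp add: \<phi>_def split: nat.split)
    ultimately obtain w where w: "w \<in> laurent_ring (exv ?T) (allv ?T) \<phi>"
      "evaluates \<phi> (cvar ?T (map Suc ks) (Suc y)) w"
      using laurent_ring_subst by meson
    have "evaluates \<phi> (cvar ?T (map Suc ks) (Suc y)) (fst (run ?T (\<phi>, bmat ?T) (map Suc ks)) (Suc y))"
      by (rule evaluates_cvar) (auto simp: \<phi>_def positive_1 positive_Xvar split: nat.split)
    also have "fst (run ?T (\<phi>, bmat ?T) (map Suc ks)) (Suc y) = cvar S ks y"
      unfolding \<phi>_def cvar_eq by (subst run_add_frozen[of ?T S _ "bmat S"]) (auto simp: add_frozen_simps)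
    finally have "w = cvar S ks y"
      using w(2) evaluates_unique by blast
    \<comment> \<open>Under \<open>\<phi>\<close> the extra variable becomes the constant
      \<open>1\<close> and the index shift is undone.\<close>
    moreover have "w \<in> laurent S"
      using w(1)
    proof induction
      case (var l)
      then show ?case
        using laurent.const[of 1 S] by (auto simp: allv_add_frozen \<phi>_def qconst_1 intro: laurent.var)
    next
      case (inv l)
      then show ?case by (auto simp: add_frozen_def \<phi>_def intro: laurent.inv)
    qed (auto intro: laurent.intros)
    ultimately show ?thesis by simp
  qed
qed

section \<open>Rooted cluster morphisms\<close>

lemma clalg_0: "0 \<in> clalg S"
  using clalg.add[OF clalg.one clalg.neg[OF clalg.one], of S] by simp

lemma clalg_power: "a \<in> clalg S \<Longrightarrow> a ^ n \<in> clalg S"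
  by (induction n) (auto intro: clalg.intros)

lemma clalg_prod: "(\<And>i. i \<in> F \<Longrightarrow> h i \<in> clalg S) \<Longrightarrow> prod h F \<in> clalg S"
  by (induction F rule: infinite_finite_induct) (auto intro: clalg.intros)

lemma clalg_of_nat: "of_nat n \<in> clalg S"
  by (induction n) (auto intro: clalg_0 clalg.intros)

lemma clalg_of_int: "of_int n \<in> clalg S"
  by (cases n rule: int_cases2) (auto intro: clalg_of_nat clalg.neg)

lemma clalg_cvar: "ks \<in> lists (exv S) \<Longrightarrow> y \<in> allv S \<Longrightarrow> cvar S ks y \<in> clalg S"
  by (rule clalg.gen) (auto simp: cluster_vars_def)

lemma cvar_Nil: "cvar S [] y = Xvar y"
  by (simp add: cvar_eq)

lemma clalg_Xvar: "y \<in> allv S \<Longrightarrow> Xvar y \<in> clalg S"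
  using clalg_cvar[of "[]" S y] by (simp add: cvar_Nil)

lemma clalg_subset_laurent:
  assumes "valid_seed S"
  shows "clalg S \<subseteq> laurent S"
proof
  fix a assume "a \<in> clalg S"
  then show "a \<in> laurent S"
  proof induction
    case (gen a)
    then show ?case using laurent_phenomenon[OF assms] by (auto simp: cluster_vars_def)
  next
    case one
    then show ?case using laurent.const[of 1] by (simp add: qconst_1)
  next
    case (neg a)
    then show ?case by (simp add: laurent_eq_laurent_ring laurent_ring_uminus)
  qed (auto intro: laurent.intros)
qed

text \<open>\<open>ring_hom_on\<close> speaks of \<open>1\<close>, sums and products only, so
  \<open>0\<close> and negatives are recovered from additivity.\<close>

lemma ring_hom_on_of_int:
  assumes "ring_hom_on R R' f" "1 \<in> R" "\<And>a. a \<in> R \<Longrightarrow> - a \<in> R" "\<And>a b. a \<in> R \<Longrightarrow> b \<in> R \<Longrightarrow> a + b \<in> R"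
  shows "f (of_int n) = of_int n"
proof -
  have hom: "f 1 = 1" "\<And>a b. a \<in> R \<Longrightarrow> b \<in> R \<Longrightarrow> f (a + b) = f a + f b"
    using assms(1) by (auto simp: ring_hom_on_def)
  have zero: "0 \<in> R"
    using assms(4)[OF assms(2) assms(3)[OF assms(2)]] by simp
  have f0: "f 0 = 0"
    using hom(2)[OF zero zero] by simp
  have nat: "of_nat n \<in> R \<and> f (of_nat n) = of_nat n" for n
    by (induction n) (use zero f0 hom assms(2,4) in auto)
  show ?thesis
  proof (cases n rule: int_cases2)
    case (nonneg m)
    then show ?thesis using nat by simp
  next
    case (nonpos m)
    have "f (of_nat m + - of_nat m) = f (of_nat m) + f (- of_nat m)"
      using nat assms(3) by (intro hom(2)) auto
    then have "f (- of_nat m) = - of_nat m"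
      using nat f0 by (simp add: eq_neg_iff_add_eq_0 add.commute)
    then show ?thesis using nonpos by simp
  qed
qed

lemma ring_hom_on_clalg_prod_power:
  assumes "ring_hom_on (clalg S) R' f" "\<And>i. i \<in> F \<Longrightarrow> h i \<in> clalg S"
  shows "f (\<Prod>i\<in>F. h i ^ e i) = (\<Prod>i\<in>F. f (h i) ^ e i)"
  using assms(2)
proof (induction F rule: infinite_finite_induct)
  case (insert x F)
  have hom: "f 1 = 1" "\<And>a b. a \<in> clalg S \<Longrightarrow> b \<in> clalg S \<Longrightarrow> f (a * b) = f a * f b"
    using assms(1) by (auto simp: ring_hom_on_def)
  have x: "h x \<in> clalg S" using insert.prems by simp
  have "f (h x ^ n) = f (h x) ^ n" for n
    by (induction n) (use hom x clalg_power[OF x] in auto)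
  moreover have "f (h x ^ e x * (\<Prod>i\<in>F. h i ^ e i)) = f (h x ^ e x) * f (\<Prod>i\<in>F. h i ^ e i)"
    using insert.prems by (intro hom clalg_prod clalg_power) auto
  ultimately show ?case
    using insert by simp
qed (use assms(1) in \<open>auto simp: ring_hom_on_def\<close>)

lemma ring_hom_on_clalg_exch:
  assumes "ring_hom_on (clalg S) R' f"
  shows "f (exch (allv S) B k Xvar) = exch (allv S) B k (\<lambda>y. f (Xvar y))"
proof -
  have "(\<Prod>y\<in>{y \<in> allv S. P y}. Xvar y ^ e y) \<in> clalg S" for P and e :: "nat \<Rightarrow> nat"
    by (intro clalg_prod clalg_power clalg_Xvar) auto
  then show ?thesis
    using assms unfolding exch_def
    by (subst (1 2) ring_hom_on_clalg_prod_power[OF assms, symmetric])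
       (auto simp: ring_hom_on_def intro: clalg_Xvar)
qed

text \<open>A constant has the same value at the points \<open>0\<close> and \<open>1\<close>, a
  variable does not.\<close>

lemma not_is_int_Xvar: "\<not> is_int (Xvar k)"
proof
  assume "is_int (Xvar k)"
  then obtain n where n: "Xvar k = of_int n" by (auto simp: is_int_def)
  have ev: "evaluates (\<lambda>_. c) (of_int n) (of_int n)" for c :: rat
    using evaluates_qconst[of "\<lambda>_. c" "of_int n"] by (simp flip: of_rat_eq_qconst)
  have "c = of_int n" for c :: rat
    using evaluates_unique[OF evaluates_Xvar[of "\<lambda>_. c" k]] ev n by metis
  from this[of 0] this[of 1] show False by simp
qed

lemma ring_hom_on_laurent_qconst:
  assumes "ring_hom_on (laurent S) R' g"
  shows "g (qconst q) = qconst q"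
proof -
  have int: "g (of_int n) = of_int n" for n
    by (rule ring_hom_on_of_int[OF assms])
       (auto simp: laurent_eq_laurent_ring intro: laurent_ring_1 laurent_ring_uminus laurent_ring.add)
  obtain a b where q: "q = of_int a / of_int b" "b \<noteq> 0"
    by (metis Fract_of_int_quotient Rat_cases less_irrefl)
  then have eq: "qconst q * qconst (of_int b) = qconst (of_int a)"
    by (simp flip: qconst_mult)
  then have "g (qconst q) * g (qconst (of_int b)) = g (qconst (of_int a))"
    using assms by (metis laurent.const ring_hom_on_def)
  then show ?thesis
    using eq int[of a] int[of b] q(2) by (metis mult_right_cancel of_int_eq_0_iff of_rat_eq_qconst of_rat_of_int_eq)
qed

text \<open>Sharpens the target to the variables that are actually hit. The image of an inverse is
  an inverse, hence the inverse of a variable in \<open>E\<close> or a rational constant.\<close>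

lemma ring_hom_on_laurent_mem:
  assumes g: "ring_hom_on (laurent S) R' g" and "E \<subseteq> A"
    and E: "\<And>k. k \<in> exv S \<Longrightarrow> g (Xvar k) \<in> Xvar ` E \<or> is_int (g (Xvar k))"
    and A: "\<And>k. k \<in> allv S \<Longrightarrow> g (Xvar k) \<in> Xvar ` A \<or> is_int (g (Xvar k))"
    and "z \<in> laurent S"
  shows "g z \<in> laurent_ring E A Xvar"
proof -
  have hom: "g 1 = 1" "\<And>a b. a \<in> laurent S \<Longrightarrow> b \<in> laurent S \<Longrightarrow> g (a + b) = g a + g b"
    "\<And>a b. a \<in> laurent S \<Longrightarrow> b \<in> laurent S \<Longrightarrow> g (a * b) = g a * g b"
    using g by (auto simp: ring_hom_on_def)
  have rat: "of_rat q \<in> laurent_ring E A Xvar" for q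
    by (simp add: of_rat_eq_qconst laurent_ring.const)
  show ?thesis
    using assms(5)
  proof induction
    case (const q)
    then show ?case by (simp add: ring_hom_on_laurent_qconst[OF g] laurent_ring.const)
  next
    case (var k)
    then show ?case
      using A[of k] rat[of "of_int n" for n] by (auto simp: is_int_def intro: laurent_ring.var)
  next
    case (inv k)
    then have k: "k \<in> allv S" by (simp add: allv_def)
    have "g (inverse (Xvar k)) * g (Xvar k) = 1"
      using hom(3)[OF laurent.inv[OF inv] laurent.var[OF k]] hom(1) by simp
    then have eq: "g (inverse (Xvar k)) = inverse (g (Xvar k))"
      by (metis inverse_unique mult.commute)
    from E[OF inv] show ?case
    proof
      assume "g (Xvar k) \<in> Xvar ` E"
      then show ?thesis by (auto simp: eq intro: laurent_ring.inv)
    next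
      assume "is_int (g (Xvar k))"
      then obtain n where "g (Xvar k) = of_int n" by (auto simp: is_int_def)
      then have "g (inverse (Xvar k)) = of_rat (inverse (of_int n))"
        by (simp add: eq of_rat_inverse)
      then show ?thesis using rat by simp
    qed
  qed (auto simp: hom intro: laurent_ring.intros)
qed

text \<open>If \<open>i\<close> were outside \<open>A\<close>, substituting \<open>1\<close> for
  \<open>Xvar i\<close> would fix the whole ring, but it moves \<open>Xvar i\<close>.\<close>

lemma Xvar_mem_laurent_ring:
  assumes "Xvar i \<in> laurent_ring I A Xvar" "I \<subseteq> A"
  shows "i \<in> A"
proof (rule ccontr)
  assume i: "i \<notin> A"
  have "evaluates (Xvar(i := 1)) z z" if "z \<in> laurent_ring I A Xvar" for z
    using that
  proof induction
    case (const q)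
    then show ?case using evaluates_qconst[of _ q] by (metis of_rat_eq_qconst)
  next
    case (var k)
    then have "(Xvar(i := 1)) k = Xvar k" using i by auto
    then show ?case using evaluates_Xvar by metis
  next
    case (inv k)
    then have "(Xvar(i := 1)) k = Xvar k" using i assms(2) by auto
    then show ?case using evaluates_Xvar evaluates_inverse Xvar_nonzero by metis
  qed (auto intro: evaluates_add evaluates_mult)
  from this[OF assms(1)] have "Xvar i = 1"
    using evaluates_unique[OF evaluates_Xvar] by fastforce
  then show False
    using not_is_int_Xvar[of i] unfolding is_int_def by (metis of_int_1 rangeI)
qed

text \<open>As \<open>Xvar i\<close> is not inverted, \<open>z\<close> has a value at
  \<open>Xvar i = 0\<close>. The product vanishes there, the exchange polynomial does not.\<close>

lemma exch_not_divisible: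
  assumes "z \<in> laurent_ring I A Xvar" "z * Xvar i = exch A' B k Xvar" "i \<notin> I"
    and "finite {y \<in> A'. B y k \<noteq> 0}"
  shows False
proof -
  let ?\<phi> = "Xvar(i := 0)"
  obtain w where "evaluates ?\<phi> z w"
    using evaluates_laurent_ring[OF assms(1), where \<phi> = ?\<phi> and u = ?\<phi>] evaluates_Xvar[of ?\<phi>] assms(3)
    by (metis Xvar_nonzero fun_upd_apply)
  then have "evaluates ?\<phi> (z * Xvar i) (w * ?\<phi> i)"
    by (intro evaluates_mult evaluates_Xvar)
  then have "evaluates ?\<phi> (exch A' B k Xvar) 0"
    by (simp add: assms(2))
  moreover have "evaluates ?\<phi> (exch A' B k Xvar) (exch A' B k ?\<phi>)"
    by (intro evaluates_exch evaluates_Xvar)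
  ultimately have "exch A' B k ?\<phi> = 0"
    using evaluates_unique by metis
  then show False
    using exch_zero_subst(1)[of A' B k i, OF assms(4)] positive_nonzero by blast
qed

text \<open>Mutation in a direction from \<open>E\<close> preserves the vanishing of the columns in
  \<open>E\<close> outside \<open>A\<close>, so every exchange polynomial met on the way involves
  only variables in \<open>A\<close>.\<close>

lemma run_restrict:
  assumes "A \<subseteq> allv S" "allv T = A" "\<And>y k. y \<in> allv S - A \<Longrightarrow> k \<in> E \<Longrightarrow> B y k = 0" "ks \<in> lists E"
  shows "run T (v, B) ks = run S (v, B) ks"
  using assms(3,4)
proof (induction ks arbitrary: v B)
  case (Cons k ks)
  have k: "k \<in> E" using Cons.prems by simp
  have "{y \<in> A. B y k > 0} = {y \<in> allv S. B y k > 0}" "{y \<in> A. B y k < 0} = {y \<in> allv S. B y k < 0}"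
    using assms(1) Cons.prems(1)[OF _ k] by force+
  then have "exch A B k v = exch (allv S) B k v"
    by (simp add: exch_def)
  moreover have "matrix_mutation k B y l = 0" if "y \<in> allv S - A" "l \<in> E" for y l
    using that k Cons.prems(1) by (simp add: matrix_mutation_def)
  ultimately show ?case
    using Cons by (simp add: mutate_eq assms(2))
qed simp

section \<open>Injective morphisms as renamings of variables\<close>

lemma rooted_cluster_morphism_exv:
  "rooted_cluster_morphism S S' f \<Longrightarrow> k \<in> exv S \<Longrightarrow> f (Xvar k) \<in> Xvar ` exv S' \<or> is_int (f (Xvar k))"
  by (simp add: rooted_cluster_morphism_def)

lemma rooted_cluster_morphism_allv:
  "rooted_cluster_morphism S S' f \<Longrightarrow> k \<in> allv S \<Longrightarrow> f (Xvar k) \<in> Xvar ` allv S' \<or> is_int (f (Xvar k))"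
  unfolding rooted_cluster_morphism_def allv_def by blast

text \<open>Integers are fixed, so injectivity forbids sending a variable to an integer; (CM1) and
  (CM2) then leave only variables.\<close>

lemma injective_morphism_renames:
  assumes f: "rooted_cluster_morphism S S' f" and inj: "inj_on f (clalg S)"
  obtains \<sigma> where "\<And>k. k \<in> allv S \<Longrightarrow> \<sigma> k \<in> allv S' \<and> f (Xvar k) = Xvar (\<sigma> k)"
    "\<And>k. k \<in> exv S \<Longrightarrow> \<sigma> k \<in> exv S'"
proof -
  have hom: "ring_hom_on (clalg S) (clalg S') f"
    using f by (simp add: rooted_cluster_morphism_def)
  have nint: "\<not> is_int (f (Xvar k))" if "k \<in> allv S" for k
  proof
    assume "is_int (f (Xvar k))"
    then obtain n where n: "f (Xvar k) = of_int n" by (auto simp: is_int_def)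
    have "f (of_int n) = of_int n"
      by (rule ring_hom_on_of_int[OF hom clalg.one clalg.neg clalg.add])
    then have "Xvar k = of_int n"
      using inj n clalg_Xvar[OF that] clalg_of_int by (metis inj_onD)
    then show False
      using not_is_int_Xvar by (metis is_int_def rangeI)
  qed
  have ex: "\<exists>j\<in>exv S'. f (Xvar k) = Xvar j" if "k \<in> exv S" for k
    using f that nint[of k] by (auto simp: rooted_cluster_morphism_def allv_def)
  have all: "\<exists>j\<in>allv S'. f (Xvar k) = Xvar j" if "k \<in> allv S" for k
    using f that nint[of k] ex[of k] by (auto simp: rooted_cluster_morphism_def allv_def)
  define \<sigma> where "\<sigma> k = (SOME j. j \<in> allv S' \<and> f (Xvar k) = Xvar j)" for k
  have \<sigma>: "\<sigma> k \<in> allv S' \<and> f (Xvar k) = Xvar (\<sigma> k)" if "k \<in> allv S" for k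
    using all[OF that] unfolding \<sigma>_def by (intro someI_ex[where P = "\<lambda>j. j \<in> allv S' \<and> f (Xvar k) = Xvar j"]) blast
  moreover have "\<sigma> k \<in> exv S'" if "k \<in> exv S" for k
    using ex[OF that] \<sigma>[of k] that by (auto simp: allv_def)
  ultimately show thesis by (rule that)
qed

text \<open>Both claims need one joint induction: the equality for \<open>ks\<close> makes the
  extension by \<open>k\<close> compatible, and (CM3) then gives the equality for the longer
  path.\<close>

lemma renaming_morphism_cvar:
  assumes f: "rooted_cluster_morphism S S' f"
    and \<sigma>: "\<And>k. k \<in> allv S \<Longrightarrow> \<sigma> k \<in> allv S' \<and> f (Xvar k) = Xvar (\<sigma> k)"
      "\<And>k. k \<in> exv S \<Longrightarrow> \<sigma> k \<in> exv S'"
    and "ks \<in> lists (exv S)"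
  shows "compatible_seqs f S S' ks (map \<sigma> ks) \<and> (\<forall>y\<in>allv S. f (cvar S ks y) = cvar S' (map \<sigma> ks) (\<sigma> y))"
  using assms(4)
proof (induction ks rule: rev_induct)
  case Nil
  then show ?case using \<sigma> by (simp add: compatible_seqs_def cvar_Nil)
next
  case (snoc k ks)
  then have IH: "compatible_seqs f S S' ks (map \<sigma> ks)" "\<forall>y\<in>allv S. f (cvar S ks y) = cvar S' (map \<sigma> ks) (\<sigma> y)"
    and k: "k \<in> exv S"
    by auto
  have "compatible_seqs f S S' (ks @ [k]) (map \<sigma> (ks @ [k]))"
    unfolding compatible_seqs_def
  proof (intro conjI allI impI)
    fix i assume "i < length (ks @ [k])"
    then consider "i < length ks" | "i = length ks" by fastforce
    then show "f (cvar S (take i (ks @ [k])) ((ks @ [k]) ! i))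
        = cvar S' (take i (map \<sigma> (ks @ [k]))) (map \<sigma> (ks @ [k]) ! i)"
    proof cases
      case 1
      then show ?thesis
        using IH(1) by (auto simp: compatible_seqs_def nth_append)
    next
      case 2
      then show ?thesis
        using IH(2) k by (simp add: nth_append allv_def)
    qed
  qed (use snoc.prems \<sigma>(2) in auto)
  then show ?case
    using f \<sigma> by (auto simp: rooted_cluster_morphism_def)
qed

theorem mainTheorem6:
  fixes S S' S'' :: seed and f f' f'' :: "qfield \<Rightarrow> qfield"
  assumes "valid_seed S" and "valid_seed S'" and "valid_seed S''"
    and "rooted_cluster_morphism S S' f" and "inducible S S' f"
    and "rooted_cluster_morphism S S'' f'" and "f' ` clalg S = clalg S''"
    and "rooted_cluster_morphism S'' S' f''" and "inj_on f'' (clalg S'')"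
    and "\<forall>a\<in>clalg S. f a = f'' (f' a)"
  shows "clalg_iso S'' (image_seed S S' f) \<and> ideal_morphism S S' f"
proof -
  define T where "T = image_seed S S' f"
  define E where "E = {j \<in> exv S'. Xvar j \<in> f ` Xvar ` exv S}"
  define A where "A = {j \<in> allv S'. Xvar j \<in> f ` Xvar ` allv S}"
  have EA: "E \<subseteq> A"
    by (auto simp: E_def A_def allv_def)
  have T: "exv T = E" "allv T = A" "bmat T = bmat S'"
    using EA by (auto simp: T_def image_seed_def E_def A_def allv_def Let_def)
  obtain \<sigma> where \<sigma>: "\<And>k. k \<in> allv S'' \<Longrightarrow> \<sigma> k \<in> allv S' \<and> f'' (Xvar k) = Xvar (\<sigma> k)"
    "\<And>k. k \<in> exv S'' \<Longrightarrow> \<sigma> k \<in> exv S'"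
    using injective_morphism_renames[OF assms(8,9)] by blast
  have cv: "f'' (cvar S'' ks y) = cvar S' (map \<sigma> ks) (\<sigma> y)"
    if "ks \<in> lists (exv S'')" "y \<in> allv S''" for ks y
    using renaming_morphism_cvar[OF assms(8), of \<sigma> ks] \<sigma> that by simp
  have hom'': "ring_hom_on (clalg S'') (clalg S') f''"
    using assms(8) by (simp add: rooted_cluster_morphism_def)
  have int'': "f'' (of_int n) = of_int n" for n
    by (rule ring_hom_on_of_int[OF hom'' clalg.one clalg.neg clalg.add])
  have sub'': "exv S'' \<subseteq> allv S''" and sub: "exv S \<subseteq> allv S"
    by (auto simp: allv_def)

  \<comment> \<open>Surjectivity of \<open>f'\<close> lifts \<open>b\<close> to \<open>a\<close>,
    the Laurent phenomenon places \<open>a\<close> in the domain of the extension \<open>g\<close>,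
    and \<open>g a = f a = f'' b\<close>.\<close>
  have img: "f'' b \<in> laurent_ring E A Xvar" if b: "b \<in> clalg S''" for b
  proof -
    obtain a where a: "a \<in> clalg S" "b = f' a"
      using b unfolding assms(7)[symmetric] by blast
    obtain g where g: "ring_hom_on (laurent S) (laurent S') g" "\<And>a. a \<in> clalg S \<Longrightarrow> g a = f a"
      using assms(5) unfolding inducible_def by blast
    have gX: "g (Xvar k) = f (Xvar k)" if "k \<in> allv S" for k
      using that by (intro g clalg_Xvar)
    have "g a \<in> laurent_ring E A Xvar"
    proof (rule ring_hom_on_laurent_mem[OF g(1) EA])
      show "a \<in> laurent S"
        using a(1) clalg_subset_laurent[OF assms(1)] by blast
      show "g (Xvar k) \<in> Xvar ` E \<or> is_int (g (Xvar k))" if k: "k \<in> exv S" for k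
        using rooted_cluster_morphism_exv[OF assms(4) k]
      proof
        assume "f (Xvar k) \<in> Xvar ` exv S'"
        then obtain j where j: "j \<in> exv S'" "f (Xvar k) = Xvar j" by blast
        then have "j \<in> E" using k unfolding E_def by (metis (mono_tags, lifting) imageI mem_Collect_eq)
        then show ?thesis using j k sub gX[of k] by auto
      qed (use k sub gX[of k] in auto)
      show "g (Xvar k) \<in> Xvar ` A \<or> is_int (g (Xvar k))" if k: "k \<in> allv S" for k
        using rooted_cluster_morphism_allv[OF assms(4) k]
      proof
        assume "f (Xvar k) \<in> Xvar ` allv S'"
        then obtain j where j: "j \<in> allv S'" "f (Xvar k) = Xvar j" by blast
        then have "j \<in> A" using k unfolding A_def by (metis (mono_tags, lifting) imageI mem_Collect_eq)
        then show ?thesis using j k sub gX[of k] by auto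
      qed (use k sub gX[of k] in auto)
    qed
    then show ?thesis
      using a g(2) assms(10) by simp
  qed

  \<comment> \<open>By \<open>img\<close> a renamed variable is Laurent in the image variables,
    hence one of them. Conversely an image variable factors through \<open>f'\<close>, where an
    integer value is excluded because \<open>f''\<close> fixes integers.\<close>
  have A_eq: "A = \<sigma> ` allv S''"
  proof
    show "\<sigma> ` allv S'' \<subseteq> A"
      using img[OF clalg_Xvar] \<sigma>(1) Xvar_mem_laurent_ring[OF _ EA] by auto
    show "A \<subseteq> \<sigma> ` allv S''"
    proof
      fix j assume "j \<in> A"
      then obtain k where k: "k \<in> allv S" "Xvar j = f (Xvar k)" by (auto simp: A_def)
      then have j: "Xvar j = f'' (f' (Xvar k))"
        using assms(10) clalg_Xvar by simp
      have "f' (Xvar k) \<in> Xvar ` allv S'' \<or> is_int (f' (Xvar k))"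
        by (rule rooted_cluster_morphism_allv[OF assms(6) k(1)])
      then show "j \<in> \<sigma> ` allv S''"
      proof
        assume "f' (Xvar k) \<in> Xvar ` allv S''"
        then show ?thesis using j \<sigma>(1) by auto
      next
        assume "is_int (f' (Xvar k))"
        then obtain n where "Xvar j = of_int n"
          using j int'' by (auto simp: is_int_def)
        then show ?thesis
          using not_is_int_Xvar[of j] by (auto simp: is_int_def)
      qed
    qed
  qed

  have exch_eq: "cvar S' [\<sigma> m] (\<sigma> m) * Xvar (\<sigma> m) = exch (allv S') (bmat S') (\<sigma> m) Xvar" for m
    by (simp add: cvar_eq mutate_eq)

  \<comment> \<open>The once mutated variable at \<open>m\<close> goes to the one at
    \<open>\<sigma> m\<close>. Were \<open>\<sigma> m\<close> outside \<open>E\<close>, its variable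
    would not be inverted in \<open>img\<close> and would divide the exchange polynomial.\<close>
  have E_eq: "E = \<sigma> ` exv S''"
  proof
    show "\<sigma> ` exv S'' \<subseteq> E"
    proof
      fix j assume "j \<in> \<sigma> ` exv S''"
      then obtain m where m: "j = \<sigma> m" "m \<in> exv S''" by blast
      have "f'' (cvar S'' [m] m) = cvar S' [\<sigma> m] (\<sigma> m)"
        using cv[of "[m]" m] m sub'' by auto
      moreover have "f'' (cvar S'' [m] m) \<in> laurent_ring E A Xvar"
        using m sub'' by (intro img clalg_cvar) auto
      moreover have "finite {y \<in> allv S'. bmat S' y (\<sigma> m) \<noteq> 0}"
        using assms(2) \<sigma>(2)[OF m(2)] unfolding valid_seed_def by blast
      ultimately show "j \<in> E"
        using exch_not_divisible[OF _ exch_eq[of m]] m(1) by metis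
    qed
    show "E \<subseteq> \<sigma> ` exv S''"
    proof
      fix j assume "j \<in> E"
      then obtain k where k: "k \<in> exv S" "Xvar j = f (Xvar k)" by (auto simp: E_def)
      then have j: "Xvar j = f'' (f' (Xvar k))"
        using assms(10) clalg_Xvar[of k S] sub by auto
      have "f' (Xvar k) \<in> Xvar ` exv S'' \<or> is_int (f' (Xvar k))"
        by (rule rooted_cluster_morphism_exv[OF assms(6) k(1)])
      then show "j \<in> \<sigma> ` exv S''"
      proof
        assume "f' (Xvar k) \<in> Xvar ` exv S''"
        then show ?thesis using j \<sigma>(1) sub'' by auto
      next
        assume "is_int (f' (Xvar k))"
        then obtain n where "Xvar j = of_int n"
          using j int'' by (auto simp: is_int_def)
        then show ?thesis
          using not_is_int_Xvar[of j] by (auto simp: is_int_def)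
      qed
    qed
  qed

  \<comment> \<open>The exchange polynomial at \<open>k\<close> is the image of the one at
    \<open>m\<close>, hence an expression in renamed variables. Setting another variable
    \<open>y\<close> to \<open>0\<close> leaves it unchanged, so \<open>y\<close> cannot
    occur.\<close>
  have column: "bmat S' y k = 0" if y: "y \<in> allv S' - A" and k: "k \<in> E" for y k
  proof (rule ccontr)
    assume nz: "bmat S' y k \<noteq> 0"
    obtain m where m: "k = \<sigma> m" "m \<in> exv S''" using k E_eq by blast
    have fin: "finite {y \<in> allv S'. bmat S' y k \<noteq> 0}"
      using assms(2) \<sigma>(2)[OF m(2)] m(1) unfolding valid_seed_def by blast
    have "f'' (cvar S'' [m] m * Xvar m) = f'' (cvar S'' [m] m) * f'' (Xvar m)"
      using hom'' m sub'' clalg_cvar[of "[m]" S'' m] clalg_Xvar[of m S''] by (auto simp: ring_hom_on_def)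
    also have "\<dots> = exch (allv S') (bmat S') k Xvar"
      using cv[of "[m]" m] \<sigma>(1)[of m] m sub'' exch_eq[of m] by auto
    also have "cvar S'' [m] m * Xvar m = exch (allv S'') (bmat S'') m Xvar"
      by (simp add: cvar_eq mutate_eq)
    also have "f'' \<dots> = exch (allv S'') (bmat S'') m (\<lambda>y. f'' (Xvar y))"
      by (rule ring_hom_on_clalg_exch[OF hom''])
    finally have eq: "exch (allv S'') (bmat S'') m (\<lambda>y. f'' (Xvar y)) = exch (allv S') (bmat S') k Xvar" .
    let ?\<phi> = "Xvar(y := 0)"
    have "evaluates ?\<phi> (f'' (Xvar l)) (f'' (Xvar l))" if "l \<in> allv S''" for l
    proof -
      have "\<sigma> l \<noteq> y" using y A_eq that by auto
      then show ?thesis using evaluates_Xvar[of ?\<phi> "\<sigma> l"] \<sigma>(1)[OF that] by simp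
    qed
    then have "evaluates ?\<phi> (exch (allv S') (bmat S') k Xvar) (exch (allv S') (bmat S') k Xvar)"
      unfolding eq[symmetric] by (rule evaluates_exch)
    moreover have "evaluates ?\<phi> (exch (allv S') (bmat S') k Xvar) (exch (allv S') (bmat S') k ?\<phi>)"
      by (intro evaluates_exch evaluates_Xvar)
    ultimately show False
      using exch_zero_subst(2)[of "allv S'" "bmat S'" k y, OF fin] y nz evaluates_unique by (metis DiffD1)
  qed

  \<comment> \<open>By \<open>column\<close>, mutation along \<open>E\<close> cannot distinguish
    \<open>S'\<close> from the subseed \<open>T\<close>.\<close>
  have cvT: "cvar T ks y = cvar S' ks y" if "ks \<in> lists E" for ks y
    unfolding cvar_eq T
    by (subst run_restrict[of A S' T E]) (use that column in \<open>auto simp: T A_def\<close>)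

  \<comment> \<open>Paths correspond under \<open>map \<sigma>\<close>, so generators match
    generators; both inclusions follow by induction over the ring operations.\<close>
  have image: "f'' ` clalg S'' = clalg T"
  proof
    show "f'' ` clalg S'' \<subseteq> clalg T"
    proof (intro image_subsetI)
      fix a assume "a \<in> clalg S''"
      then show "f'' a \<in> clalg T"
      proof induction
        case (gen a)
        then obtain ks y where a: "a = cvar S'' ks y" "ks \<in> lists (exv S'')" "y \<in> allv S''"
          by (auto simp: cluster_vars_def)
        then have l: "map \<sigma> ks \<in> lists E" by (auto simp: E_eq)
        have "f'' a = cvar T (map \<sigma> ks) (\<sigma> y)"
          using cv[OF a(2,3)] a cvT[OF l] by simp
        then show ?case
          using clalg_cvar[of "map \<sigma> ks" T "\<sigma> y"] l a(3) by (simp add: T A_eq)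
      next
        case one
        then show ?case using hom'' by (simp add: ring_hom_on_def clalg.one)
      next
        case (neg a)
        have "f'' (- a) = f'' (of_int (- 1)) * f'' a"
          using hom'' neg clalg_of_int[of "-1" S''] unfolding ring_hom_on_def by (metis mult_minus1 of_int_1 of_int_minus)
        also have "f'' (of_int (- 1)) = of_int (- 1)"
          by (rule int'')
        finally show ?case using neg.IH by (simp add: clalg.neg)
      next
        case (add a b)
        then show ?case using hom'' by (simp add: ring_hom_on_def clalg.add)
      next
        case (mult a b)
        then show ?case using hom'' by (simp add: ring_hom_on_def clalg.mult)
      qed
    qed
    show "clalg T \<subseteq> f'' ` clalg S''"
    proof
      fix a assume "a \<in> clalg T"
      then show "a \<in> f'' ` clalg S''"
      proof induction
        case (gen a)
        then obtain ks' y' where a: "a = cvar T ks' y'" "ks' \<in> lists (\<sigma> ` exv S'')" "y' \<in> \<sigma> ` allv S''"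
          by (auto simp: cluster_vars_def T A_eq E_eq)
        obtain ks where ks: "ks \<in> lists (exv S'')" "ks' = map \<sigma> ks"
          using a(2) unfolding lists_image by blast
        obtain y where y: "y \<in> allv S''" "y' = \<sigma> y"
          using a(3) by blast
        have "a = f'' (cvar S'' ks y)"
          using cv[OF ks(1) y(1)] cvT[of ks' y'] a ks(2) y(2) unfolding E_eq by simp
        then show ?case using clalg_cvar[OF ks(1) y(1)] by blast
      next
        case one
        then show ?case using hom'' clalg.one unfolding ring_hom_on_def by (metis image_eqI)
      next
        case (neg a)
        then obtain b where b: "b \<in> clalg S''" "a = f'' b" by blast
        have "f'' (of_int (- 1) * b) = f'' (of_int (- 1)) * f'' b"
          using hom'' b clalg_of_int[of "-1" S''] unfolding ring_hom_on_def by blast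
        also have "f'' (of_int (- 1)) = of_int (- 1)"
          by (rule int'')
        finally have "- a = f'' (- b)" using b by simp
        then show ?case using clalg.neg[OF b(1)] by blast
      next
        case (add a b)
        then obtain c d where "c \<in> clalg S''" "d \<in> clalg S''" "a = f'' c" "b = f'' d" by blast
        then have "a + b = f'' (c + d)" "c + d \<in> clalg S''"
          using hom'' by (auto simp: ring_hom_on_def intro: clalg.add)
        then show ?case by blast
      next
        case (mult a b)
        then obtain c d where "c \<in> clalg S''" "d \<in> clalg S''" "a = f'' c" "b = f'' d" by blast
        then have "a * b = f'' (c * d)" "c * d \<in> clalg S''"
          using hom'' by (auto simp: ring_hom_on_def intro: clalg.mult)
        then show ?case by blast
      qed
    qed
  qed

  \<comment> \<open>The same map with a smaller target. A path of \<open>T\<close> lies in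
    \<open>E\<close>, where the cluster variables of \<open>T\<close> and \<open>S'\<close> agree,
    so (CM3) descends from \<open>S'\<close>.\<close>
  have "rooted_cluster_morphism S'' T f''"
    unfolding rooted_cluster_morphism_def
  proof (intro conjI ballI allI impI)
    show "ring_hom_on (clalg S'') (clalg T) f''"
      using hom'' image by (simp add: ring_hom_on_def)
    show "f'' (Xvar k) \<in> Xvar ` exv T \<or> is_int (f'' (Xvar k))" if "k \<in> exv S''" for k
      using that \<sigma>(1)[of k] sub'' by (auto simp: T E_eq)
    show "f'' (Xvar k) \<in> Xvar ` allv T \<or> is_int (f'' (Xvar k))" if "k \<in> frv S''" for k
    proof -
      have "k \<in> allv S''" using that by (simp add: allv_def)
      then show ?thesis using \<sigma>(1)[of k] by (auto simp: T(2) A_eq)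
    qed
  next
    fix ks ks' y
    assume comp: "compatible_seqs f'' S'' T ks ks'" and y: "y \<in> allv S''"
    have E: "ks' \<in> lists E" "E \<subseteq> exv S'"
      using comp by (auto simp: compatible_seqs_def T E_def)
    have "take i ks' \<in> lists E" for i
      using E(1) in_set_takeD by fastforce
    then have comp': "compatible_seqs f'' S'' S' ks ks'"
      using comp E(2) by (auto simp: compatible_seqs_def T cvT)
    show "f'' (cvar S'' ks y) = f'' (Xvar y)" if "is_int (f'' (Xvar y))"
      using that \<sigma>(1)[OF y] not_is_int_Xvar by simp
    show "f'' (cvar S'' ks y) = cvar T ks' j" if "j \<in> allv T" "f'' (Xvar y) = Xvar j" for j
    proof -
      have "j \<in> allv S'" using that(1) by (simp add: T A_def)
      then have "f'' (cvar S'' ks y) = cvar S' ks' j"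
        using assms(8) comp' y that(2) unfolding rooted_cluster_morphism_def by blast
      then show ?thesis using cvT[OF E(1)] by simp
    qed
  qed
  then have "clalg_iso S'' T"
    unfolding clalg_iso_def rooted_cluster_iso_def bij_betw_def using image assms(9) by blast
  moreover have "f ` clalg S = f'' ` (f' ` clalg S)"
    using assms(10) by (auto simp: image_image)
  then have "ideal_morphism S S' f"
    unfolding ideal_morphism_def using image assms(7) by (simp add: T_def)
  ultimately show ?thesis
    by (simp add: T_def)
qed

end
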